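(* Let $G$ be a bridgeless cubic graph (multiple edges and loops permitted) with colouring defect $\operatorname{df}(G)=3$. Then $G$ admits a Berge cover, that is, there exist at most five perfect matchings of $G$ whose union contains every edge of $G$.
   Context: The colouring defect $\operatorname{df}(G)$ of a bridgeless cubic graph $G$ is the minimum, over all collections $\{M_1,M_2,M_3\}$ of three (not necessarily distinct) perfect matchings of $G$, of the number of edges of $G$ belonging to none of $M_1,M_2,M_3$. *)

theory Defs
  imports Main
begin

text \<open>A finite multigraph (parallel edges and loops allowed) is given by a vertex set V,
an edge set E, and an incidence map inc assigning to each edge its set of end-vertices
(one end-vertex for a loop, two for an ordinary edge).\<close>

definition multigraph :: "'v set \<Rightarrow> 'e set \<Rightarrow> ('e \<Rightarrow> 'v set) \<Rightarrow> bool" where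
  "multigraph V E inc \<longleftrightarrow> finite V \<and> finite E \<and>
     (\<forall>e\<in>E. inc e \<subseteq> V \<and> (card (inc e) = 1 \<or> card (inc e) = 2))"

definition is_loop :: "('e \<Rightarrow> 'v set) \<Rightarrow> 'e \<Rightarrow> bool" where
  "is_loop inc e \<longleftrightarrow> card (inc e) = 1"

definition degree :: "'e set \<Rightarrow> ('e \<Rightarrow> 'v set) \<Rightarrow> 'v \<Rightarrow> nat" where
  "degree E inc v = (\<Sum>e\<in>{e\<in>E. v \<in> inc e}. if is_loop inc e then 2 else 1)"

definition cubic :: "'v set \<Rightarrow> 'e set \<Rightarrow> ('e \<Rightarrow> 'v set) \<Rightarrow> bool" where
  "cubic V E inc \<longleftrightarrow> multigraph V E inc \<and> (\<forall>v\<in>V. degree E inc v = 3)"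

definition reachable :: "'e set \<Rightarrow> ('e \<Rightarrow> 'v set) \<Rightarrow> 'v \<Rightarrow> 'v \<Rightarrow> bool" where
  "reachable F inc u v \<longleftrightarrow>
     (u, v) \<in> {(x, y). \<exists>f\<in>F. x \<in> inc f \<and> y \<in> inc f}\<^sup>*"

definition is_bridge :: "'e set \<Rightarrow> ('e \<Rightarrow> 'v set) \<Rightarrow> 'e \<Rightarrow> bool" where
  "is_bridge E inc e \<longleftrightarrow> e \<in> E \<and>
     (\<exists>u v. inc e = {u, v} \<and> u \<noteq> v \<and> \<not> reachable (E - {e}) inc u v)"

definition bridgeless :: "'e set \<Rightarrow> ('e \<Rightarrow> 'v set) \<Rightarrow> bool" where
  "bridgeless E inc \<longleftrightarrow> (\<forall>e\<in>E. \<not> is_bridge E inc e)"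

definition perfect_matching :: "'v set \<Rightarrow> 'e set \<Rightarrow> ('e \<Rightarrow> 'v set) \<Rightarrow> 'e set \<Rightarrow> bool" where
  "perfect_matching V E inc M \<longleftrightarrow> M \<subseteq> E \<and> (\<forall>e\<in>M. \<not> is_loop inc e) \<and>
     (\<forall>v\<in>V. card {e\<in>M. v \<in> inc e} = 1)"

definition colouring_defect :: "'v set \<Rightarrow> 'e set \<Rightarrow> ('e \<Rightarrow> 'v set) \<Rightarrow> nat" where
  "colouring_defect V E inc = Min {card (E - (M1 \<union> M2 \<union> M3)) | M1 M2 M3.
     perfect_matching V E inc M1 \<and> perfect_matching V E inc M2 \<and> perfect_matching V E inc M3}"

end

theory Submission
  imports Defs
begin

text \<open>Three perfect matchings M1, M2, M3 leaving a minimum number of three edges uncovered determine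
  a hexagon in which uncovered edges e1, e2, e3 alternate with doubly covered edges f1, f2, f3,
  where fi is missed by Mi: otherwise an exchange along a cycle would cover more edges.
  Every edge lies in a perfect matching, so it suffices to find a perfect matching that contains
  two of the ei. By Tutte's theorem, if none contains e1 and e2, then there is a 3-edge-cut contained in
  M1 that contains f2 and f3 and has e3 on one side X. If this happens for all three pairs, a
  parity argument makes the three sets X, Y, Z disjoint, and permuting the colours inside each of
  them produces a 3-edge-colouring, contradicting the defect.\<close>

section \<open>Hall's theorem\<close>

text \<open>Everything rests on a count around the number 3. When a set \<open>R\<close> of edges
  cannot be avoided by a perfect matching, parity yields a Tutte barrier with at least |S| + 2
  members. Each member is odd and so has a cut of at least 3 edges, while the edges supply these
  cuts with at most 3|S| + 2|R| incidences. For |R| \<le> 2 this is impossible, which is why every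
  edge lies in a perfect matching. Using both \<open>e1\<close> and \<open>e2\<close> amounts to
  avoiding three edges; then every inequality is an equality, and this rigidity produces the
  3-edge-cut.

  The obstacle is that the sets found for different pairs may cross. They can be uncrossed because
  two 3-edge-cuts provide only 6 edges, whereas even differences would need cuts of at least 4 edges
  each. Recolouring inside such a set is legitimate because its whole cut lies in one matching,
  whose colour is left alone when the other two are exchanged.\<close>

lemma hall_marriage:
  assumes "finite I" "\<And>i. i \<in> I \<Longrightarrow> finite (A i)"
    and "\<And>J. J \<subseteq> I \<Longrightarrow> card J \<le> card (\<Union>(A ` J))"
  shows "\<exists>f. inj_on f I \<and> (\<forall>i\<in>I. f i \<in> A i)"
  using assms
proof (induction "card I" arbitrary: I A rule: less_induct)
  case less
  note fin = less.prems(1) and finA = less.prems(2) and hall = less.prems(3)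
  show ?case
  proof (cases "I = {}")
    case True
    then show ?thesis by simp
  next
    case False
    then obtain i where i: "i \<in> I" by blast
    show ?thesis
    proof (cases "\<forall>J. J \<subset> I \<and> J \<noteq> {} \<longrightarrow> card J < card (\<Union>(A ` J))")
      case True
      \<comment> \<open>Every nonempty proper subfamily has an element to spare, so giving
        \<open>a\<close> to \<open>i\<close> cannot break the condition for the other
        indices.\<close>
      have "card {i} \<le> card (\<Union>(A ` {i}))" using hall[of "{i}"] i by blast
      then obtain a where a: "a \<in> A i" by fastforce
      have sub: "card J \<le> card (\<Union>j\<in>J. A j - {a})" if J: "J \<subseteq> I - {i}" for J
      proof (cases "J = {}")
        case False
        have "card J < card (\<Union>(A ` J))" using True J i False by blast
        moreover have "(\<Union>j\<in>J. A j - {a}) = \<Union>(A ` J) - {a}" by blast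
        ultimately show ?thesis by (auto simp: card_Diff_singleton_if)
      qed simp
      have "\<exists>f. inj_on f (I - {i}) \<and> (\<forall>j\<in>I - {i}. f j \<in> A j - {a})"
        by (rule less.hyps[OF card_Diff1_less[OF fin i]]) (use sub fin finA in auto)
      then obtain f where f: "inj_on f (I - {i})" "\<forall>j\<in>I - {i}. f j \<in> A j - {a}" by blast
      have "inj_on (f(i := a)) I" using f by (auto simp: inj_on_def)
      moreover have "\<forall>j\<in>I. (f(i := a)) j \<in> A j" using f a by auto
      ultimately show ?thesis by blast
    next
      case False
      \<comment> \<open>Hall's condition makes \<open>J\<close> tight, so it uses up all of
        \<open>U\<close>. A deficit of some \<open>K\<close> outside \<open>U\<close> would be a
        deficit of \<open>K \<union> J\<close>, hence the rest can be matched separately.\<close>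
      then obtain J where J: "J \<subset> I" "J \<noteq> {}" "card (\<Union>(A ` J)) \<le> card J"
        by (meson leI)
      have finJ: "finite J" using J fin finite_subset by blast
      have "card J < card I" using J(1) fin psubset_card_mono by blast
      then have "\<exists>f. inj_on f J \<and> (\<forall>j\<in>J. f j \<in> A j)"
        by (rule less.hyps) (use J(1) finJ finA hall in auto)
      then obtain f where f: "inj_on f J" "\<forall>j\<in>J. f j \<in> A j" by blast
      define U where "U = \<Union>(A ` J)"
      have sub: "card K \<le> card (\<Union>k\<in>K. A k - U)" if K: "K \<subseteq> I - J" for K
      proof -
        have fK: "finite K" using K fin finite_subset by blast
        have "card K + card J = card (K \<union> J)"
          using K fK finJ by (subst card_Un_disjoint) auto
        also have "\<dots> \<le> card (\<Union>(A ` (K \<union> J)))" using hall[of "K \<union> J"] K J(1) by blast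
        also have "\<Union>(A ` (K \<union> J)) = (\<Union>k\<in>K. A k - U) \<union> U" by (auto simp: U_def)
        also have "card \<dots> \<le> card (\<Union>k\<in>K. A k - U) + card U" by (rule card_Un_le)
        finally show ?thesis using J(3) U_def by simp
      qed
      have "card (I - J) < card I" using J fin by (intro psubset_card_mono) auto
      then have "\<exists>g. inj_on g (I - J) \<and> (\<forall>j\<in>I - J. g j \<in> A j - U)"
        by (rule less.hyps) (use sub fin finA in auto)
      then obtain g where g: "inj_on g (I - J)" "\<forall>j\<in>I - J. g j \<in> A j - U" by blast
      define h where "h = (\<lambda>j. if j \<in> J then f j else g j)"
      have "f j \<in> U" if "j \<in> J" for j using f that U_def by blast
      then have "inj_on h I" using f g unfolding inj_on_def h_def
        by (metis DiffD2 DiffI)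
      moreover have "\<forall>j\<in>I. h j \<in> A j" using f g h_def by auto
      ultimately show ?thesis by blast
    qed
  qed
qed

lemma card_2_other:
  assumes "card A = 2" "a \<in> A"
  obtains b where "A = {a, b}" "a \<noteq> b"
  using assms by (auto simp: card_2_iff doubleton_eq_iff)

section \<open>Tutte's theorem\<close>

text \<open>The members of P play the role of the odd components of the graph minus S, but they need
  not be connected: it is enough that no edge leaves a member of P except towards S. This avoids
  connectivity altogether.\<close>

definition barrier :: "'e set \<Rightarrow> ('e \<Rightarrow> 'v set) \<Rightarrow> 'v set \<Rightarrow> 'v set \<Rightarrow> 'v set set \<Rightarrow> bool" where
  "barrier F inc W S P \<longleftrightarrow> S \<subseteq> W \<and>
     (\<forall>C\<in>P. C \<subseteq> W - S \<and> odd (card C) \<and>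
        (\<forall>e\<in>F. inc e \<subseteq> W \<and> inc e \<inter> C \<noteq> {} \<longrightarrow> inc e \<subseteq> C \<union> S)) \<and>
     pairwise disjnt P"

text \<open>Stated relative to a vertex set \<open>W\<close>, so that the induction for Tutte's
  theorem can pass to smaller vertex sets while \<open>F\<close> and \<open>inc\<close> stay
  fixed.\<close>

definition matching_on :: "'e set \<Rightarrow> ('e \<Rightarrow> 'v set) \<Rightarrow> 'v set \<Rightarrow> 'e set \<Rightarrow> bool" where
  "matching_on F inc W M \<longleftrightarrow> M \<subseteq> F \<and> (\<forall>e\<in>M. inc e \<subseteq> W) \<and> (\<forall>v\<in>W. \<exists>!e. e \<in> M \<and> v \<in> inc e)"

lemma matching_on_UN:
  assumes "\<And>i. i \<in> I \<Longrightarrow> matching_on F inc (W i) (M i)"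
    and disj: "\<And>i j. i \<in> I \<Longrightarrow> j \<in> I \<Longrightarrow> i \<noteq> j \<Longrightarrow> W i \<inter> W j = {}"
  shows "matching_on F inc (\<Union>i\<in>I. W i) (\<Union>i\<in>I. M i)"
  unfolding matching_on_def
proof (intro conjI ballI)
  fix v assume "v \<in> (\<Union>i\<in>I. W i)"
  then obtain i where i: "i \<in> I" "v \<in> W i" by blast
  then obtain e where e: "e \<in> M i" "v \<in> inc e" and uniq: "\<And>e'. e' \<in> M i \<Longrightarrow> v \<in> inc e' \<Longrightarrow> e' = e"
    using assms(1) unfolding matching_on_def by metis
  show "\<exists>!e. e \<in> (\<Union>i\<in>I. M i) \<and> v \<in> inc e"
  proof (intro ex1I[of _ e])
    fix e' assume "e' \<in> (\<Union>i\<in>I. M i) \<and> v \<in> inc e'"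
    then obtain j where j: "j \<in> I" "e' \<in> M j" "v \<in> inc e'" by blast
    then have "v \<in> W j" using assms(1) unfolding matching_on_def by blast
    then have "j = i" using disj i j by blast
    then show "e' = e" using uniq j by blast
  qed (use e i in blast)
qed (use assms(1) in \<open>auto simp: matching_on_def; blast\<close>)+

lemma matching_on_Un:
  assumes "matching_on F inc A M" "matching_on F inc B N" "A \<inter> B = {}"
  shows "matching_on F inc (A \<union> B) (M \<union> N)"
proof -
  have "matching_on F inc (\<Union>b. if b then A else B) (\<Union>b. if b then M else N)"
    by (rule matching_on_UN) (use assms in auto)
  then show ?thesis by (simp add: UNIV_bool Un_commute)
qed

lemma barrier_rest_closed:
  assumes "barrier F inc W S P" "e \<in> F" "inc e \<subseteq> W" "inc e \<inter> (W - S - \<Union>P) \<noteq> {}"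
  shows "inc e \<subseteq> (W - S - \<Union>P) \<union> S"
  using assms unfolding barrier_def by blast

lemma barrier_member_unique:
  assumes "barrier F inc W S P" "C \<in> P" "D \<in> P" "C \<inter> D \<noteq> {}"
  shows "C = D"
  using assms pairwiseD[of disjnt P C D] by (auto simp: barrier_def disjnt_def)

lemma barrier_insert_rest:
  assumes "barrier F inc W S P" "odd (card (W - S - \<Union>P))"
  shows "barrier F inc W S (insert (W - S - \<Union>P) P)"
  using assms barrier_rest_closed[OF assms(1)]
  by (auto simp: barrier_def pairwise_def disjnt_def)

lemma finite_barrier:
  assumes "barrier F inc W S P" "finite W"
  shows "finite P" "finite S" "C \<in> P \<Longrightarrow> finite C"
proof -
  have "P \<subseteq> Pow W" using assms(1) by (auto simp: barrier_def)
  then show "finite P" using assms(2) finite_subset by blast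
qed (use assms finite_subset in \<open>auto simp: barrier_def; blast\<close>)+

lemma even_card_barrier_rest:
  assumes b: "barrier F inc W S P" and fin: "finite W"
  shows "even (card W) \<longleftrightarrow> even (card S + card P + card (W - S - \<Union>P))"
proof -
  note f = finite_barrier[OF b fin]
  have "card (\<Union>P) = sum card P"
    using b f by (intro card_Union_disjoint) (auto simp: barrier_def)
  moreover have "{C \<in> P. odd (card C)} = P" using b by (auto simp: barrier_def)
  ultimately have p: "even (card (\<Union>P)) \<longleftrightarrow> even (card P)"
    using f by (simp add: even_sum_iff)
  have sub: "S \<union> \<Union>P \<subseteq> W" and "S \<inter> \<Union>P = {}" using b by (auto simp: barrier_def)
  then have "card (S \<union> \<Union>P) = card S + card (\<Union>P)" using f by (simp add: card_Un_disjoint)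
  moreover have "card W = card (W - (S \<union> \<Union>P)) + card (S \<union> \<Union>P)"
    using card_Diff_subset[OF finite_subset[OF sub fin] sub] card_mono[OF fin sub] by simp
  moreover have "W - (S \<union> \<Union>P) = W - S - \<Union>P" by blast
  ultimately have "card W = card S + card (\<Union>P) + card (W - S - \<Union>P)" by simp
  then show ?thesis using p by simp
qed

text \<open>For even |W|, a barrier with |P| = |S| + 1 leaves an odd number of vertices outside
  \<open>S\<close> and \<open>\<Union>P\<close>. No relevant edge leaves this remainder except
  towards \<open>S\<close>, so it can be added as a further member.\<close>

lemma barrier_gap:
  assumes b: "barrier F inc W S P" and fin: "finite W" and "even (card W)" "card S < card P"
  shows "\<exists>Q. barrier F inc W S Q \<and> card S + 2 \<le> card Q"
proof (cases "card P = card S + 1")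
  case True
  let ?D = "W - S - \<Union>P"
  have odd: "odd (card ?D)" using even_card_barrier_rest[OF b fin] assms(3) True by simp
  then have "?D \<notin> P" by (metis Diff_disjoint Sup_upper card.empty dvd_0_right inf.absorb_iff2)
  then have "card (insert ?D P) = card S + 2" using True finite_barrier[OF b fin] by simp
  then show ?thesis using barrier_insert_rest[OF b odd] by (metis order_refl)
qed (use assms in \<open>auto intro!: exI[of _ P]\<close>)

text \<open>Take a barrier with as many members as separating vertices and with S as large as possible.
  By maximality the members exhaust the rest of the graph and each member minus any one of its vertices
  satisfies the induction hypothesis; Hall's theorem then matches the members with S.\<close>

theorem tutte_matching:
  assumes "finite W" and two: "\<And>e. e \<in> F \<Longrightarrow> card (inc e) = 2"
    and "\<And>S P. barrier F inc W S P \<Longrightarrow> card P \<le> card S"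
  shows "\<exists>M. matching_on F inc W M"
  using assms(1,3)
proof (induction "card W" arbitrary: W rule: less_induct)
  case less
  note fin = less.prems(1) and tutte = less.prems(2)
  define T where "T = {S. \<exists>P. barrier F inc W S P \<and> card P = card S}"
  have "T \<subseteq> Pow W" by (auto simp: T_def barrier_def)
  then have "finite T" using fin finite_subset by blast
  moreover have "{} \<in> T" by (auto simp: T_def barrier_def intro!: exI[of _ "{}"])
  ultimately obtain S where S: "S \<in> T" and max: "\<And>S'. S' \<in> T \<Longrightarrow> card S' \<le> card S"
    using obtains_MAX[of T card] by (metis Max_ge empty_iff finite_imageI imageI)
  obtain P where b: "barrier F inc W S P" and cP: "card P = card S" using S T_def by blast
  note f = finite_barrier[OF b fin]
  have SW: "S \<subseteq> W" and PW: "\<And>C. C \<in> P \<Longrightarrow> C \<subseteq> W - S" and oddP: "\<And>C. C \<in> P \<Longrightarrow> odd (card C)"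
    and closed: "\<And>C e. C \<in> P \<Longrightarrow> e \<in> F \<Longrightarrow> inc e \<subseteq> W \<Longrightarrow> inc e \<inter> C \<noteq> {} \<Longrightarrow> inc e \<subseteq> C \<union> S"
    and disj: "\<And>C D. C \<in> P \<Longrightarrow> D \<in> P \<Longrightarrow> C \<noteq> D \<Longrightarrow> C \<inter> D = {}"
    using b by (auto simp: barrier_def pairwise_def disjnt_def)
  \<comment> \<open>Tutte's condition turns the last inequality into an equality, so
    \<open>S'\<close> would belong to \<open>T\<close> and contradict the maximality of
    \<open>S\<close>.\<close>
  have no_larger: False if "barrier F inc W S' P'" "card S < card S'" "card S' \<le> card P'" for S' P'
    using that tutte[OF that(1)] max[of S'] by (auto simp: T_def)
  define D where "D = W - S - \<Union>P"
  have D_closed: "inc e \<subseteq> D \<union> S" if "e \<in> F" "inc e \<subseteq> W" "inc e \<inter> D \<noteq> {}" for e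
    using barrier_rest_closed[OF b] that by (simp add: D_def)
  have "even (card D)"
  proof (rule ccontr)
    assume odd: "odd (card D)"
    then have "D \<noteq> {}" by auto
    then have "D \<notin> P" by (auto simp: D_def)
    then show False using tutte[OF barrier_insert_rest[OF b odd[unfolded D_def]]] cP f
      by (simp add: D_def)
  qed
  have "D = {}"
  proof (rule ccontr)
    assume "D \<noteq> {}"
    then obtain v where v: "v \<in> D" by blast
    have finD: "finite D" using fin by (simp add: D_def)
    have odd: "odd (card (D - {v}))" using \<open>even (card D)\<close> v finD
      by (simp add: card_Diff_singleton) (metis empty_iff)
    then have "D - {v} \<noteq> {}" by (metis card.empty dvd_0_right)
    then have "D - {v} \<notin> P" by (auto simp: D_def)
    \<comment> \<open>Moving \<open>v\<close> from the even set \<open>D\<close> to \<open>S\<close>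
      leaves an odd remainder, so both sides of |S| = |P| grow by one.\<close>
    have "barrier F inc W (insert v S) (insert (D - {v}) P)"
      unfolding barrier_def
    proof (intro conjI ballI)
      fix C assume C: "C \<in> insert (D - {v}) P"
      show "C \<subseteq> W - insert v S" using C PW v by (auto simp: D_def)
      show "odd (card C)" using C odd oddP by blast
      fix e assume "e \<in> F"
      then show "inc e \<subseteq> W \<and> inc e \<inter> C \<noteq> {} \<longrightarrow> inc e \<subseteq> C \<union> insert v S"
        using C closed[of C e] D_closed[of e] by blast
    next
      show "pairwise disjnt (insert (D - {v}) P)"
        using b by (auto simp: barrier_def pairwise_insert D_def disjnt_def)
    qed (use SW v D_def in auto)
    then show False
    proof (rule no_larger)
      show "card S < card (insert v S)" "card (insert v S) \<le> card (insert (D - {v}) P)"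
        using v f cP \<open>D - {v} \<notin> P\<close> by (auto simp: D_def)
    qed
  qed
  then have W: "W = S \<union> \<Union>P" using SW PW by (auto simp: D_def)
  have critical: "\<exists>M. matching_on F inc (C - {v}) M" if C: "C \<in> P" and v: "v \<in> C" for C v
  proof (rule less.hyps)
    have finC: "finite C" using f C by blast
    show "card (C - {v}) < card W"
      using C v PW fin by (intro psubset_card_mono) auto
    show "finite (C - {v})" using finC by simp
    fix T Q assume TQ: "barrier F inc (C - {v}) T Q"
    show "card Q \<le> card T"
    proof (rule ccontr)
      assume "\<not> ?thesis"
      moreover have "even (card (C - {v}))" using oddP[OF C] v finC by simp
      ultimately obtain Q where Q: "barrier F inc (C - {v}) T Q" and big: "card T + 2 \<le> card Q"
        using barrier_gap[OF TQ] finC by auto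
      have TC: "T \<subseteq> C - {v}" and QC: "\<And>B. B \<in> Q \<Longrightarrow> B \<subseteq> C - {v} - T"
        and oddQ: "\<And>B. B \<in> Q \<Longrightarrow> odd (card B)"
        and closedQ: "\<And>B e. B \<in> Q \<Longrightarrow> e \<in> F \<Longrightarrow> inc e \<subseteq> C - {v} \<Longrightarrow> inc e \<inter> B \<noteq> {} \<Longrightarrow> inc e \<subseteq> B \<union> T"
        using Q by (auto simp: barrier_def)
      have finQ: "finite Q" "finite T" using finite_barrier[OF Q] finC by auto
      have two_ends: "inc e \<subseteq> B \<union> X" 
        if h: "e \<in> F" "x \<in> inc e" "x \<in> X" "inc e \<inter> B \<noteq> {}" "x \<notin> B" for e B X x
      proof -
        obtain a c where "inc e = {a, c}" using two[OF h(1)] by (auto simp: card_2_iff)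
        then show ?thesis using h by auto
      qed
      \<comment> \<open>The member \<open>C\<close> is replaced by the members of \<open>Q\<close>.
        The separating set grows by |T| + 1, and the number of members by |Q| - 1 \<ge> |T| + 1; the
        surplus of two obtained from parity pays for both \<open>v\<close> and the loss of
        \<open>C\<close>.\<close>
      let ?S = "S \<union> insert v T" and ?P = "(P - {C}) \<union> Q"
      have "barrier F inc W ?S ?P"
        unfolding barrier_def
      proof (intro conjI ballI)
        fix B assume B: "B \<in> ?P"
        show "B \<subseteq> W - ?S" using B PW[of B] PW[OF C] disj[OF _ C, of B] TC QC[of B] v by blast
        show "odd (card B)" using B oddP oddQ by blast
        fix e assume e: "e \<in> F"
        show "inc e \<subseteq> W \<and> inc e \<inter> B \<noteq> {} \<longrightarrow> inc e \<subseteq> B \<union> ?S"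
        proof (intro impI)
          assume h: "inc e \<subseteq> W \<and> inc e \<inter> B \<noteq> {}"
          show "inc e \<subseteq> B \<union> ?S"
          proof (cases "B \<in> Q")
            case False
            then show ?thesis using closed[of B e] B e h by blast
          next
            case True
            have "inc e \<subseteq> C \<union> S" using closed[OF C e] h QC[OF True] by blast
            show ?thesis
            proof (cases "inc e \<subseteq> C - {v}")
              case True
              then show ?thesis using closedQ[OF \<open>B \<in> Q\<close> e] h by blast
            next
              case False
              then obtain x where "x \<in> inc e" "x \<in> insert v S" using \<open>inc e \<subseteq> C \<union> S\<close> by blast
              moreover have "x \<notin> B" using calculation QC[OF True] PW[OF C] by blast
              ultimately show ?thesis using two_ends[OF e, of x "insert v S" B] h by blast
            qed
          qed
        qed
      next
        show "?S \<subseteq> W" using SW TC C PW[OF C] v by blast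
        have "disjnt A B" if "A \<in> P - {C}" "B \<in> Q" for A B
          using that disj[of A C] C QC[of B] by (auto simp: disjnt_def)
        then show "pairwise disjnt ?P"
          using b Q unfolding barrier_def pairwise_def by (metis Diff_iff Un_iff disjnt_sym)
      qed
      then show False
      proof (rule no_larger)
        have dis: "S \<inter> insert v T = {}" using PW[OF C] TC v by blast
        have cS: "card ?S = card S + card T + 1"
          using card_Un_disjoint[OF f(2) _ dis] finQ TC by (auto simp: card_insert_if)
        show "card S < card ?S" using cS by simp
        have "B \<notin> P - {C}" if "B \<in> Q" for B
          using that disj[of B C] C QC[of B] oddQ[of B] by (metis Diff_iff Diff_subset card.empty dvd_0_right inf.absorb_iff1 singletonI subset_trans)
        then have "card ?P = card (P - {C}) + card Q"
          using finQ f by (intro card_Un_disjoint) auto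
        also have "card (P - {C}) = card S - 1" using C f cP by simp
        finally show "card ?S \<le> card ?P" using cS big by simp
      qed
    qed
  qed
  define N where "N C = {s \<in> S. \<exists>e\<in>F. \<exists>r\<in>C. inc e = {r, s}}" for C
  have "\<exists>g. inj_on g P \<and> (\<forall>C\<in>P. g C \<in> N C)"
  proof (rule hall_marriage)
    fix J assume J: "J \<subseteq> P"
    \<comment> \<open>The neighbours of \<open>J\<close> in \<open>S\<close> already separate its
      members from the rest, so Hall's condition is an instance of Tutte's.\<close>
    have "barrier F inc W (\<Union>(N ` J)) J"
      unfolding barrier_def
    proof (intro conjI ballI)
      fix C assume C: "C \<in> J"
      show "C \<subseteq> W - \<Union>(N ` J)" using PW C J by (auto simp: N_def)
      show "odd (card C)" using oddP C J by blast
      fix e assume e: "e \<in> F"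
      show "inc e \<subseteq> W \<and> inc e \<inter> C \<noteq> {} \<longrightarrow> inc e \<subseteq> C \<union> \<Union>(N ` J)"
      proof (intro impI)
        assume h: "inc e \<subseteq> W \<and> inc e \<inter> C \<noteq> {}"
        then obtain r where r: "r \<in> inc e" "r \<in> C" by blast
        obtain s where s: "inc e = {r, s}" using card_2_other[OF two[OF e] r(1)] by metis
        have "s \<in> C \<union> S" using closed[of C e] C J e h s by blast
        then show "inc e \<subseteq> C \<union> \<Union>(N ` J)" using s r e C by (auto simp: N_def)
      qed
    next
      show "\<Union>(N ` J) \<subseteq> W" using SW by (auto simp: N_def)
      show "pairwise disjnt J" using b J pairwise_subset by (auto simp: barrier_def)
    qed
    then show "card J \<le> card (\<Union>(N ` J))" by (rule tutte)
  qed (use f in \<open>auto simp: N_def\<close>)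
  then obtain g where g: "inj_on g P" "\<And>C. C \<in> P \<Longrightarrow> g C \<in> N C" by blast
  have "g ` P = S"
    using g f cP by (intro card_subset_eq) (auto simp: N_def card_image)
  have "\<exists>M. matching_on F inc (insert (g C) C) M" if C: "C \<in> P" for C
  proof -
    obtain e r where e: "e \<in> F" "r \<in> C" "inc e = {r, g C}" "g C \<in> S" using g(2)[OF C] by (auto simp: N_def)
    obtain M where M: "matching_on F inc (C - {r}) M" using critical C e by blast
    have "matching_on F inc {r, g C} {e}" using e by (auto simp: matching_on_def)
    then have "matching_on F inc (C - {r} \<union> {r, g C}) (M \<union> {e})"
      using matching_on_Un[OF M] e PW[OF C] by blast
    moreover have "C - {r} \<union> {r, g C} = insert (g C) C" using e by auto
    ultimately show ?thesis by metis
  qed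
  then obtain M where M: "\<And>C. C \<in> P \<Longrightarrow> matching_on F inc (insert (g C) C) (M C)" by metis
  have "matching_on F inc (\<Union>C\<in>P. insert (g C) C) (\<Union>C\<in>P. M C)"
  proof (rule matching_on_UN)
    fix C B assume CB: "C \<in> P" "B \<in> P" "C \<noteq> B"
    then have "g C \<noteq> g B" "g C \<in> S" "g B \<in> S" using g \<open>g ` P = S\<close> by (auto simp: inj_on_def)
    then show "insert (g C) C \<inter> insert (g B) B = {}" using CB disj[of C B] PW[of C] PW[of B] by blast
  qed (rule M)
  moreover have "(\<Union>C\<in>P. insert (g C) C) = W" using W \<open>g ` P = S\<close> by auto
  ultimately show ?case by metis
qed

section \<open>Perfect matchings avoiding few edges\<close>

definition edge_cut :: "'e set \<Rightarrow> ('e \<Rightarrow> 'v set) \<Rightarrow> 'v set \<Rightarrow> 'e set" where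
  "edge_cut F inc C = {e \<in> F. inc e \<inter> C \<noteq> {} \<and> \<not> inc e \<subseteq> C}"

text \<open>A walk that starts in \<open>C\<close> and avoids \<open>e\<close> can never leave
  \<open>C\<close>.\<close>

lemma cut_singleton_bridge:
  assumes "multigraph V E inc" and cut: "edge_cut E inc C = {e}"
  shows "is_bridge E inc e"
proof -
  have e: "e \<in> E" "inc e \<inter> C \<noteq> {}" "\<not> inc e \<subseteq> C" using cut by (auto simp: edge_cut_def)
  then have "card (inc e) \<noteq> 1" by (auto simp: card_1_singleton_iff)
  then have two: "card (inc e) = 2" using assms(1) e by (auto simp: multigraph_def)
  obtain u where u: "u \<in> inc e" "u \<in> C" using e by blast
  obtain v where v: "inc e = {u, v}" "u \<noteq> v" using card_2_other[OF two u(1)] .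
  have "x \<in> C" if "(u, x) \<in> {(x, y). \<exists>f\<in>E - {e}. x \<in> inc f \<and> y \<in> inc f}\<^sup>*" for x
    using that
  proof (induction rule: rtrancl_induct)
    case (step y z)
    then obtain f where f: "f \<in> E" "f \<noteq> e" "y \<in> inc f" "z \<in> inc f" by blast
    then have "f \<notin> edge_cut E inc C" using cut by blast
    then show ?case using f step by (auto simp: edge_cut_def)
  qed (rule u)
  moreover have "v \<notin> C" using v e u by auto
  ultimately show ?thesis using e v by (auto simp: is_bridge_def reachable_def)
qed

locale bridgeless_cubic =
  fixes V :: "'v set" and E :: "'e set" and inc :: "'e \<Rightarrow> 'v set"
  assumes finV: "finite V" and finE: "finite E"
    and inc_V: "e \<in> E \<Longrightarrow> inc e \<subseteq> V"
    and card_inc: "e \<in> E \<Longrightarrow> card (inc e) = 2"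
    and deg: "v \<in> V \<Longrightarrow> card {e \<in> E. v \<in> inc e} = 3"
    and cut_ne_1: "C \<subseteq> V \<Longrightarrow> card (edge_cut E inc C) \<noteq> 1"

text \<open>A loop takes two of the three units of degree at its vertex. The single further edge
  there would form the whole cut of that vertex, hence a bridge; so loops cannot occur.\<close>

lemma bridgeless_cubicI:
  assumes c: "cubic V E inc" and b: "bridgeless E inc"
  shows "bridgeless_cubic V E inc"
proof -
  have mg: "multigraph V E inc" and d: "\<And>v. v \<in> V \<Longrightarrow> degree E inc v = 3"
    using c by (auto simp: cubic_def)
  then have fin: "finite V" "finite E" and sub: "\<And>e. e \<in> E \<Longrightarrow> inc e \<subseteq> V"
    and one_two: "\<And>e. e \<in> E \<Longrightarrow> card (inc e) = 1 \<or> card (inc e) = 2"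
    by (auto simp: multigraph_def)
  have cut: "card (edge_cut E inc C) \<noteq> 1" for C
  proof
    assume "card (edge_cut E inc C) = 1"
    then obtain e where "edge_cut E inc C = {e}" by (auto simp: card_1_singleton_iff)
    then have "is_bridge E inc e" by (rule cut_singleton_bridge[OF mg])
    then show False using b by (auto simp: bridgeless_def is_bridge_def)
  qed
  have noloop: "card (inc e) \<noteq> 1" if e: "e \<in> E" for e
  proof
    assume loop: "card (inc e) = 1"
    then obtain v where v: "inc e = {v}" by (auto simp: card_1_singleton_iff)
    let ?A = "{e \<in> E. v \<in> inc e}" and ?w = "\<lambda>e. if is_loop inc e then 2 else 1 :: nat"
    have "sum ?w ?A = ?w e + sum ?w (?A - {e})"
      using e v fin by (intro sum.remove) auto
    moreover have "sum ?w ?A = 3" using d[of v] sub[OF e] v by (simp add: degree_def)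
    ultimately have "sum ?w (?A - {e}) = Suc 0" using loop by (simp add: is_loop_def)
    then obtain f where f: "f \<in> ?A - {e}" "?w f = Suc 0" "\<And>g. g \<in> ?A - {e} \<Longrightarrow> f \<noteq> g \<Longrightarrow> ?w g = 0"
      using fin by (subst (asm) sum_eq_Suc0_iff) auto
    have "card (inc f) = 2" using one_two[of f] f by (auto simp: is_loop_def)
    have "\<not> inc f \<subseteq> {v}"
    proof
      assume "inc f \<subseteq> {v}"
      then have "card (inc f) \<le> 1" using card_mono[of "{v}"] by auto
      then show False using \<open>card (inc f) = 2\<close> by simp
    qed
    then have "f \<in> edge_cut E inc {v}" using f by (auto simp: edge_cut_def)
    moreover have "g = f" if "g \<in> edge_cut E inc {v}" for g
    proof -
      have "g \<in> ?A - {e}" using that v by (auto simp: edge_cut_def)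
      then show ?thesis using f(3)[of g] by (metis zero_neq_numeral zero_neq_one)
    qed
    ultimately have "edge_cut E inc {v} = {f}" by blast
    then show False using cut[of "{v}"] by simp
  qed
  show ?thesis
  proof
    show "card {e \<in> E. v \<in> inc e} = 3" if "v \<in> V" for v
    proof -
      have "degree E inc v = (\<Sum>e\<in>{e\<in>E. v \<in> inc e}. 1)"
        unfolding degree_def using noloop by (intro sum.cong) (auto simp: is_loop_def)
      then show ?thesis using d[OF that] by simp
    qed
  qed (use fin sub cut one_two noloop in auto)
qed

context bridgeless_cubic
begin

abbreviation pm :: "'e set \<Rightarrow> bool" where
  "pm \<equiv> perfect_matching V E inc"

lemma finite_inc: "e \<in> E \<Longrightarrow> finite (inc e)"
  using inc_V finV finite_subset by blast

lemma pm_iff: "pm M \<longleftrightarrow> M \<subseteq> E \<and> (\<forall>v\<in>V. card {e \<in> M. v \<in> inc e} = 1)"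
  using card_inc by (auto simp: perfect_matching_def is_loop_def)

lemma pm_iff_ex1: "pm M \<longleftrightarrow> M \<subseteq> E \<and> (\<forall>v\<in>V. \<exists>!e. e \<in> M \<and> v \<in> inc e)"
  by (simp add: pm_iff card_1_singleton_iff set_eq_iff) metis

lemma pm_unique:
  assumes "pm M" "e \<in> M" "f \<in> M" "v \<in> inc e" "v \<in> inc f"
  shows "e = f"
  using assms inc_V unfolding pm_iff_ex1 by blast

lemma matching_on_pm: "matching_on (E - R) inc V M \<Longrightarrow> pm M \<and> M \<inter> R = {}"
  by (auto simp: pm_iff_ex1 matching_on_def)

section \<open>Parity of edge cuts\<close>

lemma double_count:
  assumes "F \<subseteq> E" "C \<subseteq> V"
  shows "(\<Sum>v\<in>C. card {e \<in> F. v \<in> inc e}) = (\<Sum>e\<in>F. card (inc e \<inter> C))"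
proof -
  have "finite F" "finite C" using assms finE finV finite_subset by blast+
  from sum.swap_restrict[OF this(2,1), of "\<lambda>_ _. 1::nat" "\<lambda>v e. v \<in> inc e"]
  show ?thesis by (simp add: Int_def conj_commute)
qed

lemma in_cut_iff:
  assumes "e \<in> E" "inc e = {a, b}"
  shows "e \<in> edge_cut E inc C \<longleftrightarrow> (a \<in> C \<longleftrightarrow> b \<notin> C)"
  using assms by (auto simp: edge_cut_def)

lemma cut_sub: "F \<subseteq> E \<Longrightarrow> edge_cut F inc C = edge_cut E inc C \<inter> F"
  by (auto simp: edge_cut_def)

lemma finite_cut: "F \<subseteq> E \<Longrightarrow> finite (edge_cut F inc C)"
  using finE by (auto simp: edge_cut_def finite_subset)

lemma odd_card_inter_iff:
  assumes "e \<in> E"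
  shows "odd (card (inc e \<inter> C)) \<longleftrightarrow> e \<in> edge_cut E inc C"
proof -
  obtain a b where "inc e = {a, b}" "a \<noteq> b" using card_inc[OF assms] by (auto simp: card_2_iff)
  then show ?thesis using in_cut_iff[OF assms] by (auto simp: Int_insert_left)
qed

text \<open>Summing the degrees in \<open>F\<close> over \<open>C\<close> counts edges inside
  \<open>C\<close> twice and cut edges once, so modulo 2 only the cut survives. The form with
  \<open>F\<close> serves perfect matchings as well as \<open>E\<close> itself.\<close>

lemma odd_card_cut:
  assumes F: "F \<subseteq> E" and C: "C \<subseteq> V" and "\<And>v. v \<in> C \<Longrightarrow> odd (card {e \<in> F. v \<in> inc e})"
  shows "odd (card (edge_cut F inc C)) \<longleftrightarrow> odd (card C)"
proof -
  have fin: "finite F" "finite C" using assms finE finV finite_subset by blast+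
  have "{v \<in> C. odd (card {e \<in> F. v \<in> inc e})} = C" using assms(3) by blast
  then have "odd (card C) \<longleftrightarrow> odd (\<Sum>v\<in>C. card {e \<in> F. v \<in> inc e})"
    using fin by (simp add: even_sum_iff)
  also have "\<dots> \<longleftrightarrow> odd (card {e \<in> F. odd (card (inc e \<inter> C))})"
    using fin by (simp add: double_count[OF F C] even_sum_iff)
  also have "{e \<in> F. odd (card (inc e \<inter> C))} = edge_cut F inc C"
    using F odd_card_inter_iff by (auto simp: cut_sub[OF F])
  finally show ?thesis by simp
qed

lemma odd_card_cut_pm:
  assumes "pm M" "C \<subseteq> V"
  shows "odd (card (edge_cut M inc C)) \<longleftrightarrow> odd (card C)"
  using assms by (intro odd_card_cut) (auto simp: pm_iff)

lemma odd_card_cut_E: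
  assumes "C \<subseteq> V"
  shows "odd (card (edge_cut E inc C)) \<longleftrightarrow> odd (card C)"
  using assms deg by (intro odd_card_cut) auto

lemma card_cut_ge_3:
  assumes "C \<subseteq> V" "odd (card C)"
  shows "3 \<le> card (edge_cut E inc C)"
  using odd_card_cut_E[OF assms(1)] assms(2) cut_ne_1[OF assms(1)]
  by (cases "card (edge_cut E inc C)"; cases "card (edge_cut E inc C) = 2") auto

lemma even_card_V: "even (card V)"
proof -
  have "edge_cut E inc V = {}" using inc_V by (auto simp: edge_cut_def)
  then show ?thesis using odd_card_cut_E[of V] by simp
qed

section \<open>Counting the edges that leave the members of a barrier\<close>

lemma large_barrier:
  assumes "\<nexists>M. pm M \<and> M \<inter> R = {}"
  obtains S P where "barrier (E - R) inc V S P" "card S + 2 \<le> card P"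
proof -
  obtain S P where "barrier (E - R) inc V S P" "card S < card P"
    using tutte_matching[of V "E - R" inc] finV card_inc matching_on_pm assms
    by (metis Diff_iff leI)
  then show ?thesis using barrier_gap[OF _ finV even_card_V] that by blast
qed

definition cut_count :: "'v set set \<Rightarrow> 'e \<Rightarrow> nat" where
  "cut_count P e = card {C \<in> P. e \<in> edge_cut E inc C}"

lemma sum_card_cut:
  assumes "finite P" "F \<subseteq> E"
  shows "(\<Sum>C\<in>P. card (edge_cut F inc C)) = (\<Sum>e\<in>F. cut_count P e)"
proof -
  have "finite F" using assms finE finite_subset by blast
  from sum.swap_restrict[OF assms(1) this, of "\<lambda>_ _. 1::nat" "\<lambda>C e. e \<in> edge_cut E inc C"]
  show ?thesis by (simp add: cut_count_def cut_sub[OF assms(2)] Int_def conj_commute)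
qed

text \<open>Each member whose cut contains \<open>e\<close> contains an end of \<open>e\<close>
  outside \<open>S\<close>, and disjoint members contain different ends.\<close>

lemma cut_count_le_Diff:
  assumes b: "barrier F inc V S P" and e: "e \<in> E"
  shows "cut_count P e \<le> card (inc e - S)"
  unfolding cut_count_def
proof (rule card_inj_on_le)
  let ?g = "\<lambda>C. SOME x. x \<in> inc e \<inter> C"
  have g: "?g C \<in> inc e \<inter> C" if "C \<in> {C \<in> P. e \<in> edge_cut E inc C}" for C
  proof -
    have "\<exists>x. x \<in> inc e \<inter> C" using that by (auto simp: edge_cut_def)
    then show ?thesis by (rule someI_ex)
  qed
  show "inj_on ?g {C \<in> P. e \<in> edge_cut E inc C}"
  proof (rule inj_onI)
    fix C D assume CD: "C \<in> {C \<in> P. e \<in> edge_cut E inc C}" "D \<in> {C \<in> P. e \<in> edge_cut E inc C}" "?g C = ?g D"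
    then have "C \<inter> D \<noteq> {}" using g[OF CD(1)] g[OF CD(2)] by auto
    then show "C = D" using barrier_member_unique[OF b] CD by blast
  qed
  show "?g ` {C \<in> P. e \<in> edge_cut E inc C} \<subseteq> inc e - S"
  proof
    fix x assume "x \<in> ?g ` {C \<in> P. e \<in> edge_cut E inc C}"
    then obtain C where C: "C \<in> {C \<in> P. e \<in> edge_cut E inc C}" "x = ?g C" by blast
    then show "x \<in> inc e - S" using g[OF C(1)] b by (auto simp: barrier_def)
  qed
  show "finite (inc e - S)" using finite_inc[OF e] by simp
qed

text \<open>An edge outside \<open>R\<close> that leaves a member has its other end in
  \<open>S\<close>, so only one end remains for a member.\<close>

lemma cut_count_le_Int:
  assumes b: "barrier (E - R) inc V S P" and e: "e \<in> E - R"
  shows "cut_count P e \<le> card (inc e \<inter> S)"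
proof (cases "{C \<in> P. e \<in> edge_cut E inc C} = {}")
  case True
  then show ?thesis unfolding cut_count_def True by simp
next
  case False
  then obtain C where C: "C \<in> P" "e \<in> edge_cut E inc C" by blast
  then have "inc e \<subseteq> C \<union> S" using b e inc_V by (auto simp: barrier_def edge_cut_def)
  then have "inc e \<inter> S \<noteq> {}" using C by (auto simp: edge_cut_def)
  moreover have fin: "finite (inc e)" using finite_inc e by simp
  ultimately have "0 < card (inc e \<inter> S)" by (simp add: card_gt_0_iff)
  moreover have "card (inc e) = card (inc e \<inter> S) + card (inc e - S)"
    using card_Int_Diff[OF fin] .
  moreover have "cut_count P e \<le> card (inc e - S)" using cut_count_le_Diff b e by blast
  ultimately show ?thesis using card_inc e by simp
qed

lemma cut_count_le_2:
  assumes "barrier F inc V S P" "e \<in> E"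
  shows "cut_count P e \<le> 2"
proof -
  have "card (inc e - S) \<le> card (inc e)"
    using finite_inc[OF assms(2)] by (intro card_mono) auto
  then show ?thesis using cut_count_le_Diff[OF assms] card_inc[OF assms(2)] by simp
qed

text \<open>An edge of \<open>R\<close> may join two members directly and is charged 2; any other
  edge is charged to its ends in \<open>S\<close>, so that these charges add up to at most the
  degree sum 3|S|.\<close>

definition barrier_bound :: "'e set \<Rightarrow> 'v set \<Rightarrow> 'e \<Rightarrow> nat" where
  "barrier_bound R S e = (if e \<in> R then 2 else card (inc e \<inter> S))"

lemma cut_count_le_bound:
  assumes "barrier (E - R) inc V S P" "e \<in> E"
  shows "cut_count P e \<le> barrier_bound R S e"
  using cut_count_le_2[OF assms] cut_count_le_Int[OF assms(1), of e] assms(2)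
  by (auto simp: barrier_bound_def)

lemma sum_barrier_bound_le:
  assumes "S \<subseteq> V" "R \<subseteq> E"
  shows "(\<Sum>e\<in>E. barrier_bound R S e) \<le> 3 * card S + 2 * card R"
proof -
  have R: "finite R" using assms finE finite_subset by blast
  have "(\<Sum>e\<in>E. barrier_bound R S e) = (\<Sum>e\<in>E - R. card (inc e \<inter> S)) + 2 * card R"
    using assms finE sum.subset_diff[of R E "barrier_bound R S"] by (simp add: barrier_bound_def)
  also have "(\<Sum>e\<in>E - R. card (inc e \<inter> S)) \<le> (\<Sum>e\<in>E. card (inc e \<inter> S))"
    using finE by (intro sum_mono2) auto
  also have "\<dots> = (\<Sum>v\<in>S. card {e \<in> E. v \<in> inc e})" using double_count[of E S] assms by simp
  also have "\<dots> = 3 * card S" using deg assms by (simp add: subset_iff)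
  finally show ?thesis by simp
qed

lemma barrier_count:
  assumes b: "barrier (E - R) inc V S P" and R: "R \<subseteq> E"
  shows "3 * card P \<le> (\<Sum>C\<in>P. card (edge_cut E inc C))"
    and "(\<Sum>C\<in>P. card (edge_cut E inc C)) \<le> (\<Sum>e\<in>E. barrier_bound R S e)"
    and "(\<Sum>e\<in>E. barrier_bound R S e) \<le> 3 * card S + 2 * card R"
proof -
  have finP: "finite P" using finite_barrier[OF b finV] by blast
  have "(\<Sum>C\<in>P. 3) \<le> (\<Sum>C\<in>P. card (edge_cut E inc C))"
    using b by (intro sum_mono card_cut_ge_3) (auto simp: barrier_def)
  then show "3 * card P \<le> (\<Sum>C\<in>P. card (edge_cut E inc C))" by simp
  show "(\<Sum>C\<in>P. card (edge_cut E inc C)) \<le> (\<Sum>e\<in>E. barrier_bound R S e)"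
    unfolding sum_card_cut[OF finP order_refl] by (intro sum_mono cut_count_le_bound[OF b])
  show "(\<Sum>e\<in>E. barrier_bound R S e) \<le> 3 * card S + 2 * card R"
    using b R by (intro sum_barrier_bound_le) (auto simp: barrier_def)
qed

text \<open>The surplus of two members requires 6 further incidences, and two avoided edges supply
  at most 4.\<close>

lemma pm_avoiding_two_edges:
  assumes "R \<subseteq> E" "card R \<le> 2"
  shows "\<exists>M. pm M \<and> M \<inter> R = {}"
proof (rule ccontr)
  assume "\<not> ?thesis"
  then obtain S P where "barrier (E - R) inc V S P" "card S + 2 \<le> card P"
    by (rule large_barrier)
  then show False using barrier_count[of R S P] assms by simp
qed

text \<open>Avoiding the two other edges at one end of \<open>e\<close> forces \<open>e\<close> into
  the matching.\<close>

lemma pm_containing_edge: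
  assumes "e \<in> E"
  shows "\<exists>M. pm M \<and> e \<in> M"
proof -
  obtain v where v: "v \<in> inc e" using card_inc[OF assms] by fastforce
  let ?A = "{e \<in> E. v \<in> inc e}"
  have vV: "v \<in> V" using inc_V assms v by blast
  have "card (?A - {e}) = 2" using deg[OF vV] assms v by simp
  then obtain M where M: "pm M" "M \<inter> (?A - {e}) = {}"
    using pm_avoiding_two_edges[of "?A - {e}"] by auto
  obtain f where "f \<in> M" "v \<in> inc f" using M(1) vV unfolding pm_iff_ex1 by blast
  then have "f = e" using M by (auto simp: pm_iff)
  then show ?thesis using M \<open>f \<in> M\<close> by blast
qed

text \<open>For |R| = 3 the two ends of the chain in \<open>barrier_count\<close> coincide, so
  equality holds term by term. In particular an edge of \<open>R\<close> joins two members and has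
  no end in \<open>S\<close>. A perfect matching \<open>M\<close> therefore contributes one
  incidence for each vertex of \<open>S\<close> and two for each edge of
  \<open>M \<inter> R\<close>.\<close>

lemma tight_barrier:
  assumes R: "R \<subseteq> E" "card R = 3" and no: "\<nexists>M. pm M \<and> M \<inter> R = {}"
  obtains S P where "barrier (E - R) inc V S P" "card P = card S + 2"
    "\<And>C. C \<in> P \<Longrightarrow> card (edge_cut E inc C) = 3"
    "\<And>e. e \<in> R \<Longrightarrow> cut_count P e = 2"
    "\<And>M. pm M \<Longrightarrow> (\<Sum>C\<in>P. card (edge_cut M inc C)) = card S + 2 * card (M \<inter> R)"
proof -
  obtain S P where b: "barrier (E - R) inc V S P" and "card S + 2 \<le> card P"
    using no by (rule large_barrier)
  note count = barrier_count[OF b R(1)]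
  have cP: "card P = card S + 2" using count R(2) \<open>card S + 2 \<le> card P\<close> by simp
  have finP: "finite P" using finite_barrier[OF b finV] by blast
  have SV: "S \<subseteq> V" using b by (auto simp: barrier_def)
  have cut3: "card (edge_cut E inc C) = 3" if "C \<in> P" for C
  proof -
    have eq: "(\<Sum>C\<in>P. 3) = (\<Sum>C\<in>P. card (edge_cut E inc C))" using count cP R(2) by simp
    have "3 \<le> card (edge_cut E inc C)" if "C \<in> P" for C
      using b that by (intro card_cut_ge_3) (auto simp: barrier_def)
    from sum_mono_inv[OF eq this \<open>C \<in> P\<close> finP] show ?thesis by simp
  qed
  have tight: "cut_count P e = barrier_bound R S e" if "e \<in> E" for e
  proof -
    have "sum (cut_count P) E = sum (barrier_bound R S) E"
      using count cP R(2) sum_card_cut[OF finP order_refl] by simp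
    from sum_mono_inv[OF this cut_count_le_bound[OF b] that finE] show ?thesis .
  qed
  have RS: "inc e \<inter> S = {}" if e: "e \<in> R" for e
  proof -
    have eE: "e \<in> E" using e R by blast
    have "2 \<le> card (inc e - S)"
      using cut_count_le_Diff[OF b eE] tight[OF eE] e by (simp add: barrier_bound_def)
    moreover have fin: "finite (inc e)" using finite_inc[OF eE] .
    ultimately have "card (inc e \<inter> S) = 0" using card_Int_Diff[OF fin, of S] card_inc[OF eE] by linarith
    then show ?thesis using fin by simp
  qed
  have "(\<Sum>C\<in>P. card (edge_cut M inc C)) = card S + 2 * card (M \<inter> R)" if M: "pm M" for M
  proof -
    have ME: "M \<subseteq> E" using M by (simp add: pm_iff)
    have finM: "finite M" using ME finE finite_subset by blast
    have "(\<Sum>C\<in>P. card (edge_cut M inc C)) = (\<Sum>e\<in>M. cut_count P e)" by (rule sum_card_cut[OF finP ME])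
    also have "\<dots> = (\<Sum>e\<in>M. card (inc e \<inter> S) + (if e \<in> R then 2 else 0))"
      using tight ME RS by (intro sum.cong) (auto simp: barrier_bound_def)
    also have "\<dots> = (\<Sum>v\<in>S. card {e \<in> M. v \<in> inc e}) + 2 * card (M \<inter> R)"
      using finM by (simp add: sum.distrib double_count[OF ME SV] sum.If_cases)
    also have "(\<Sum>v\<in>S. card {e \<in> M. v \<in> inc e}) = card S"
      using M SV by (simp add: pm_iff subset_iff)
    finally show ?thesis .
  qed
  moreover have "cut_count P e = 2" if "e \<in> R" for e
    using tight[of e] R that by (auto simp: barrier_bound_def)
  ultimately show ?thesis using that b cP cut3 by blast
qed

lemma vertex_edges:
  assumes "v \<in> V" "a \<in> E" "b \<in> E" "c \<in> E" "v \<in> inc a" "v \<in> inc b" "v \<in> inc c"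
    and "a \<noteq> b" "a \<noteq> c" "b \<noteq> c"
  shows "{e \<in> E. v \<in> inc e} = {a, b, c}"
proof -
  have "card {e \<in> E. v \<in> inc e} = card {a, b, c}" using deg[OF assms(1)] assms by simp
  moreover have "{a, b, c} \<subseteq> {e \<in> E. v \<in> inc e}" using assms by blast
  ultimately show ?thesis using finE by (intro card_subset_eq[symmetric]) auto
qed

text \<open>Posimodularity of the cut function. An edge counted twice on the left joins
  \<open>X - Y\<close> to \<open>Y - X\<close> and hence crosses both \<open>X\<close> and
  \<open>Y\<close>; an edge counted once crosses at least one of them.\<close>

lemma card_cut_uncross:
  "card (edge_cut E inc (X - Y)) + card (edge_cut E inc (Y - X))
     \<le> card (edge_cut E inc X) + card (edge_cut E inc Y)"
proof -
  have two: "\<exists>a b. inc e = {a, b}" if "e \<in> E" for e using card_inc[OF that] by (auto simp: card_2_iff)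
  have *: "e \<in> edge_cut E inc (X - Y) \<union> edge_cut E inc (Y - X) \<longrightarrow> e \<in> edge_cut E inc X \<union> edge_cut E inc Y"
    "e \<in> edge_cut E inc (X - Y) \<inter> edge_cut E inc (Y - X) \<longrightarrow> e \<in> edge_cut E inc X \<inter> edge_cut E inc Y"
    if "e \<in> E" for e
    using two[OF that] in_cut_iff[OF that] by auto
  then have "edge_cut E inc (X - Y) \<union> edge_cut E inc (Y - X) \<subseteq> edge_cut E inc X \<union> edge_cut E inc Y"
    "edge_cut E inc (X - Y) \<inter> edge_cut E inc (Y - X) \<subseteq> edge_cut E inc X \<inter> edge_cut E inc Y"
    by (auto simp: edge_cut_def)
  then have "card (edge_cut E inc (X - Y) \<union> edge_cut E inc (Y - X)) \<le> card (edge_cut E inc X \<union> edge_cut E inc Y)"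
    "card (edge_cut E inc (X - Y) \<inter> edge_cut E inc (Y - X)) \<le> card (edge_cut E inc X \<inter> edge_cut E inc Y)"
    by (auto intro!: card_mono finite_cut)
  then show ?thesis
    using card_Un_Int[OF finite_cut finite_cut, of E E X Y]
      card_Un_Int[OF finite_cut finite_cut, of E E "X - Y" "Y - X"] by simp
qed

text \<open>A perfect matching meets the cut of an even set in an even number of edges, so in at
  least two if it meets it at all; \<open>M\<close> and \<open>N\<close> share none of them.\<close>

lemma card_cut_ge_4:
  assumes pm: "pm M" "pm N" and C: "C \<subseteq> V" "even (card C)"
    and "a \<in> M" "a \<in> edge_cut E inc C" "b \<in> N" "b \<in> edge_cut E inc C" "M \<inter> N \<inter> edge_cut E inc C = {}"
  shows "4 \<le> card (edge_cut E inc C)"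
proof -
  have sub: "M \<subseteq> E" "N \<subseteq> E" using pm by (auto simp: pm_iff)
  have 2: "2 \<le> card (edge_cut L inc C)" if "pm L" "x \<in> L" "x \<in> edge_cut E inc C" for L x
  proof -
    have L: "L \<subseteq> E" using that by (simp add: pm_iff)
    have "x \<in> edge_cut L inc C" using that L by (auto simp: edge_cut_def)
    then have "0 < card (edge_cut L inc C)" using finite_cut[OF L] by (auto simp: card_gt_0_iff)
    moreover have "even (card (edge_cut L inc C))" using odd_card_cut_pm[OF that(1) C(1)] C(2) by simp
    ultimately show ?thesis by (cases "card (edge_cut L inc C) = 1") auto
  qed
  have "card (edge_cut M inc C \<union> edge_cut N inc C) = card (edge_cut M inc C) + card (edge_cut N inc C)"
    using assms(9) by (intro card_Un_disjoint finite_cut sub) (auto simp: cut_sub[OF sub(1)] cut_sub[OF sub(2)])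
  moreover have "card (edge_cut M inc C \<union> edge_cut N inc C) \<le> card (edge_cut E inc C)"
    using sub by (intro card_mono finite_cut) (auto simp: edge_cut_def)
  ultimately show ?thesis using 2[of M a] 2[of N b] assms by simp
qed

end

section \<open>The hexagon of uncovered and doubly covered edges\<close>

locale hexagon = bridgeless_cubic V E inc
  for V :: "'v set" and E :: "'e set" and inc :: "'e \<Rightarrow> 'v set" +
  fixes M1 M2 M3 :: "'e set" and v1 v2 v3 v4 v5 v6 :: 'v and e1 e2 e3 f1 f2 f3 :: 'e
  assumes pms: "pm M1" "pm M2" "pm M3"
    and dist: "distinct [v1, v2, v3, v4, v5, v6]"
    and inc_e: "inc e1 = {v1, v2}" "inc e2 = {v3, v4}" "inc e3 = {v5, v6}"
    and inc_f: "inc f1 = {v2, v3}" "inc f2 = {v4, v5}" "inc f3 = {v6, v1}"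
    and uncovered: "E - (M1 \<union> M2 \<union> M3) = {e1, e2, e3}"
    and double: "M2 \<inter> M3 = {f1}" "M3 \<inter> M1 = {f2}" "M1 \<inter> M2 = {f3}"
    and not_triple: "f1 \<notin> M1" "f2 \<notin> M2" "f3 \<notin> M3"
begin

text \<open>Shifting the vertices by two shifts the indices of edges and matchings by one.
  Interpreting the locale along this symmetry supplies the other two versions of each later
  lemma.\<close>

lemma rotate: "hexagon V E inc M2 M3 M1 v3 v4 v5 v6 v1 v2 e2 e3 e1 f2 f3 f1"
  using pms dist inc_e inc_f uncovered double not_triple
  by unfold_locales (auto simp: Un_ac)

abbreviation hex_vertices :: "'v set" where
  "hex_vertices \<equiv> {v1, v2, v3, v4, v5, v6}"

abbreviation hex_edges :: "'e set" where
  "hex_edges \<equiv> {e1, e2, e3, f1, f2, f3}"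

lemma pms_sub: "M1 \<subseteq> E" "M2 \<subseteq> E" "M3 \<subseteq> E"
  using pms by (auto simp: pm_iff)

lemma e_mem: "e1 \<in> E" "e2 \<in> E" "e3 \<in> E"
  "e1 \<notin> M1" "e1 \<notin> M2" "e1 \<notin> M3" "e2 \<notin> M1" "e2 \<notin> M2" "e2 \<notin> M3" "e3 \<notin> M1" "e3 \<notin> M2" "e3 \<notin> M3"
  using uncovered by auto

lemma f_mem: "f1 \<in> M2" "f1 \<in> M3" "f2 \<in> M3" "f2 \<in> M1" "f3 \<in> M1" "f3 \<in> M2" "f1 \<in> E" "f2 \<in> E" "f3 \<in> E"
  using double pms_sub by auto

lemma hex_V: "v1 \<in> V" "v2 \<in> V" "v3 \<in> V" "v4 \<in> V" "v5 \<in> V" "v6 \<in> V"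
  using inc_V[OF e_mem(1)] inc_V[OF e_mem(2)] inc_V[OF e_mem(3)] inc_e by auto

text \<open>At \<open>v1\<close> the edge \<open>f3\<close> serves both \<open>M1\<close> and
  \<open>M2\<close>, and \<open>e1\<close> serves no matching, so only the third edge is left for
  \<open>M3\<close>.\<close>

lemma third_edge_v1:
  obtains g where "{e \<in> E. v1 \<in> inc e} = {e1, f3, g}" "g \<in> M3" "g \<notin> M1" "g \<notin> M2" "g \<notin> hex_edges" "v1 \<in> inc g"
proof -
  obtain g where g: "g \<in> M3" "v1 \<in> inc g" using pms(3) hex_V(1) unfolding pm_iff_ex1 by blast
  then have "g \<noteq> f3" "g \<noteq> e1" using not_triple e_mem by auto
  then have "{e \<in> E. v1 \<in> inc e} = {e1, f3, g}"
    using g pms_sub e_mem f_mem hex_V inc_e inc_f by (intro vertex_edges) auto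
  moreover have "g \<notin> M1" using g pm_unique[OF pms(1), of g f3 v1] f_mem inc_f \<open>g \<noteq> f3\<close> by auto
  moreover have "g \<notin> M2" using g pm_unique[OF pms(2), of g f3 v1] f_mem inc_f \<open>g \<noteq> f3\<close> by auto
  moreover have "g \<notin> hex_edges" using calculation g e_mem f_mem by auto
  ultimately show ?thesis using that g by blast
qed

lemma third_edge_v2:
  obtains g where "{e \<in> E. v2 \<in> inc e} = {e1, f1, g}" "g \<in> M1" "g \<notin> M2" "g \<notin> M3" "g \<notin> hex_edges" "v2 \<in> inc g"
proof -
  obtain g where g: "g \<in> M1" "v2 \<in> inc g" using pms(1) hex_V(2) unfolding pm_iff_ex1 by blast
  then have "g \<noteq> f1" "g \<noteq> e1" using not_triple e_mem by auto
  then have "{e \<in> E. v2 \<in> inc e} = {e1, f1, g}"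
    using g pms_sub e_mem f_mem hex_V inc_e inc_f by (intro vertex_edges) auto
  moreover have "g \<notin> M2" using g pm_unique[OF pms(2), of g f1 v2] f_mem inc_f \<open>g \<noteq> f1\<close> by auto
  moreover have "g \<notin> M3" using g pm_unique[OF pms(3), of g f1 v2] f_mem inc_f \<open>g \<noteq> f1\<close> by auto
  moreover have "g \<notin> hex_edges" using calculation g e_mem f_mem by auto
  ultimately show ?thesis using that g by blast
qed

end

section \<open>Odd sets whose 3-edge-cut lies in one matching, and their uncrossing\<close>

definition pocket :: "'v set \<Rightarrow> 'e set \<Rightarrow> ('e \<Rightarrow> 'v set) \<Rightarrow> 'e set \<Rightarrow> 'v set \<Rightarrow> 'v set \<Rightarrow> 'v set \<Rightarrow> bool" where
  "pocket V E inc M H D X \<longleftrightarrow> X \<subseteq> V \<and> odd (card X) \<and> card (edge_cut E inc X) = 3 \<and>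
     edge_cut E inc X \<subseteq> M \<and> X \<inter> H = D"

lemma pocket_mem: "pocket V E inc M H D X \<Longrightarrow> v \<in> H \<Longrightarrow> v \<in> X \<longleftrightarrow> v \<in> D"
  by (auto simp: pocket_def)

lemma minimal_pocket:
  assumes "pocket V E inc M H D X"
  obtains X' where "pocket V E inc M H D X'"
    "\<And>X''. pocket V E inc M H D X'' \<Longrightarrow> card X' \<le> card X''"
  using ex_has_least_nat[of "pocket V E inc M H D" X card] assms by blast

context hexagon
begin

text \<open>A perfect matching contains e1 and e2 iff it avoids f1 and the third edges at v2 and v3. If there
  is none, the barrier count for these three edges is tight, and counting the edges of M1 shows
  that some member X of the barrier has all three edges of its cut in M1; as M2 and M3 also
  meet the cut, it contains f2 and f3.\<close>

lemma pocket_if_no_pm: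
  assumes no: "\<nexists>N. pm N \<and> e1 \<in> N \<and> e2 \<in> N"
  shows "\<exists>X. pocket V E inc M1 hex_vertices {v5, v6} X"
proof -
  interpret r: hexagon V E inc M2 M3 M1 v3 v4 v5 v6 v1 v2 e2 e3 e1 f2 f3 f1 by (rule rotate)
  obtain g2 where g2: "{e \<in> E. v2 \<in> inc e} = {e1, f1, g2}" "g2 \<in> M1" "v2 \<in> inc g2"
    by (rule third_edge_v2)
  obtain g3 where g3: "{e \<in> E. v3 \<in> inc e} = {e2, f1, g3}" "g3 \<in> M1" "v3 \<in> inc g3"
    by (rule r.third_edge_v1)
  let ?R = "{f1, g2, g3}"
  have RE: "?R \<subseteq> E" using f_mem g2 g3 pms_sub by auto
  have avoid: "\<nexists>N. pm N \<and> N \<inter> ?R = {}"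
  proof
    assume "\<exists>N. pm N \<and> N \<inter> ?R = {}"
    then obtain N where N: "pm N" "N \<inter> ?R = {}" by blast
    obtain a b where ab: "a \<in> N" "v2 \<in> inc a" "b \<in> N" "v3 \<in> inc b"
      using N(1) hex_V unfolding pm_iff_ex1 by metis
    then have "a \<in> {e1, f1, g2}" "b \<in> {e2, f1, g3}"
      using N(1) g2(1) g3(1) unfolding pm_iff by blast+
    then show False using ab N no by auto
  qed
  \<comment> \<open>If two of these edges coincided, at most two edges would have to be avoided,
    which is always possible.\<close>
  have "\<not> card ?R \<le> 2" using pm_avoiding_two_edges[OF RE] avoid by blast
  then have cR: "card ?R = 3" by (auto simp: card_insert_if split: if_splits)
  then have g23: "g2 \<noteq> g3" by (auto simp: card_insert_if split: if_splits)
  obtain S P where b: "barrier (E - ?R) inc V S P" and cP: "card P = card S + 2"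
    and cut3: "\<And>C. C \<in> P \<Longrightarrow> card (edge_cut E inc C) = 3"
    and count: "\<And>e. e \<in> ?R \<Longrightarrow> cut_count P e = 2"
    and sum: "\<And>M. pm M \<Longrightarrow> (\<Sum>C\<in>P. card (edge_cut M inc C)) = card S + 2 * card (M \<inter> ?R)"
    using tight_barrier[OF RE cR avoid] by metis
  have finP: "finite P" using finite_barrier[OF b finV] by blast
  have "M1 \<inter> ?R = {g2, g3}" using g2 g3 not_triple by auto
  then have sum1: "(\<Sum>C\<in>P. card (edge_cut M1 inc C)) = card P + 2"
    using sum[OF pms(1)] g23 cP by simp
  \<comment> \<open>The sum exceeds the number of members, so some cut contains more than one edge
    of \<open>M1\<close>. By parity it contains at least three, which is the entire cut.\<close>
  have "\<exists>X\<in>P. 1 < card (edge_cut M1 inc X)"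
  proof (rule ccontr)
    assume "\<not> ?thesis"
    then have "(\<Sum>C\<in>P. card (edge_cut M1 inc C)) \<le> (\<Sum>C\<in>P. 1)" by (intro sum_mono) (auto simp: not_less)
    then show False using sum1 by simp
  qed
  then obtain X where X: "X \<in> P" "1 < card (edge_cut M1 inc X)" by blast
  have XV: "X \<subseteq> V" and oddX: "odd (card X)" using b X by (auto simp: barrier_def)
  have "odd (card (edge_cut M1 inc X))" using odd_card_cut_pm[OF pms(1) XV] oddX by simp
  then have "3 \<le> card (edge_cut M1 inc X)" using X(2)
    by (cases "card (edge_cut M1 inc X) = 2") auto
  moreover have sub: "edge_cut M1 inc X \<subseteq> edge_cut E inc X" by (auto simp: cut_sub[OF pms_sub(1)])
  ultimately have "edge_cut M1 inc X = edge_cut E inc X"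
    using cut3[OF X(1)] finite_cut[of E X] by (intro card_seteq) auto
  then have cutM1: "edge_cut E inc X \<subseteq> M1" by (auto simp: edge_cut_def)
  have meets: "edge_cut M inc X \<noteq> {}" if "pm M" for M
    using odd_card_cut_pm[OF that XV] oddX by auto
  have f2X: "f2 \<in> edge_cut E inc X"
    using meets[OF pms(3)] cutM1 double by (auto simp: cut_sub[OF pms_sub(3)])
  \<comment> \<open>By tightness the ends of \<open>f1\<close> lie in two different members, both
    having \<open>f1\<close> in their cuts. The cut of \<open>X\<close> lies in \<open>M1\<close>
    and so misses \<open>f1\<close>; hence \<open>X\<close> is neither of these members.\<close>
  have off_f1: "X \<inter> {v2, v3} = {}"
  proof (rule ccontr)
    assume ne: "X \<inter> {v2, v3} \<noteq> {}"
    obtain A B where AB: "{C \<in> P. f1 \<in> edge_cut E inc C} = {A, B}" "A \<noteq> B"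
      using count[of f1] by (auto simp: cut_count_def card_2_iff)
    then have A: "A \<in> P" "f1 \<in> edge_cut E inc A" and B: "B \<in> P" "f1 \<in> edge_cut E inc B" by auto
    have "A \<inter> B = {}" using barrier_member_unique[OF b A(1) B(1)] AB(2) by blast
    moreover have "A \<inter> {v2, v3} \<noteq> {}" "B \<inter> {v2, v3} \<noteq> {}" using A B inc_f by (auto simp: edge_cut_def)
    ultimately have "X \<inter> A \<noteq> {} \<or> X \<inter> B \<noteq> {}" using ne by blast
    then have "X = A \<or> X = B" using barrier_member_unique[OF b X(1)] A B by blast
    then show False using A B cutM1 not_triple by blast
  qed
  have not_cut: "e1 \<notin> edge_cut E inc X" "e2 \<notin> edge_cut E inc X" "e3 \<notin> edge_cut E inc X"
    using cutM1 e_mem by auto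
  have "v1 \<notin> X" "v4 \<notin> X" using not_cut off_f1 in_cut_iff e_mem inc_e by auto
  moreover have "v5 \<in> X" using f2X \<open>v4 \<notin> X\<close> in_cut_iff[of f2] f_mem inc_f by auto
  moreover have "v6 \<in> X" using not_cut \<open>v5 \<in> X\<close> in_cut_iff[of e3] e_mem inc_e by auto
  ultimately have "X \<inter> hex_vertices = {v5, v6}" using off_f1 by auto
  then show ?thesis using XV oddX cut3[OF X(1)] cutM1 by (auto simp: pocket_def)
qed

text \<open>The two differences have the same parity, and their cuts have at most 6 edges in total.
  If both were even, \<open>M2\<close> and \<open>M3\<close> would force 4 edges in the cut of
  \<open>X - Y\<close>, and \<open>M3\<close> and \<open>M1\<close> would force 4 in that of
  \<open>Y - X\<close>. So both are odd with cuts of exactly 3 edges; \<open>M1\<close> contains the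
  two cut edges \<open>f2\<close> and \<open>f3\<close> of \<open>X - Y\<close>, and by parity also
  the third.\<close>

lemma pocket_uncross:
  assumes X: "pocket V E inc M1 hex_vertices {v5, v6} X"
    and Y: "pocket V E inc M2 hex_vertices {v1, v2} Y"
  shows "pocket V E inc M1 hex_vertices {v5, v6} (X - Y)"
proof -
  let ?A = "X - Y" and ?B = "Y - X"
  have XV: "X \<subseteq> V" "Y \<subseteq> V" and odd: "odd (card X)" "odd (card Y)"
    using X Y by (auto simp: pocket_def)
  have memX: "v5 \<in> X" "v6 \<in> X" "v1 \<notin> X" "v2 \<notin> X" "v3 \<notin> X" "v4 \<notin> X" using dist by (auto simp: pocket_mem[OF X])
  have memY: "v1 \<in> Y" "v2 \<in> Y" "v3 \<notin> Y" "v4 \<notin> Y" "v5 \<notin> Y" "v6 \<notin> Y" using dist by (auto simp: pocket_mem[OF Y])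
  have sum: "card (edge_cut E inc ?A) + card (edge_cut E inc ?B) \<le> 6"
    using card_cut_uncross[of X Y] X Y by (simp add: pocket_def)
  have AV: "?A \<subseteq> V" "?B \<subseteq> V" using XV by auto
  have fin: "finite X" "finite Y" using XV finV finite_subset by auto
  have "card X = card (X \<inter> Y) + card ?A" "card Y = card (X \<inter> Y) + card ?B"
    using card_Int_Diff[OF fin(1), of Y] card_Int_Diff[OF fin(2), of X] by (simp_all add: Int_commute)
  then have par: "odd (card ?A) \<longleftrightarrow> odd (card ?B)" using odd by presburger
  have cutA: "f2 \<in> edge_cut E inc ?A" "f3 \<in> edge_cut E inc ?A" "f1 \<notin> edge_cut E inc ?A"
    using in_cut_iff[OF _ inc_f(1)] in_cut_iff[OF _ inc_f(2)] in_cut_iff[OF _ inc_f(3)] f_mem memX memY by auto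
  have cutB: "f1 \<in> edge_cut E inc ?B" "f3 \<in> edge_cut E inc ?B" "f2 \<notin> edge_cut E inc ?B"
    using in_cut_iff[OF _ inc_f(1)] in_cut_iff[OF _ inc_f(2)] in_cut_iff[OF _ inc_f(3)] f_mem memX memY by auto
  have oddA: "odd (card ?A)"
  proof (rule ccontr)
    assume ev: "\<not> odd (card ?A)"
    have "4 \<le> card (edge_cut E inc ?A)"
      using card_cut_ge_4[OF pms(2,3) AV(1), of f3 f2] ev cutA f_mem double by auto
    moreover have "4 \<le> card (edge_cut E inc ?B)"
      using card_cut_ge_4[OF pms(3,1) AV(2), of f1 f3] ev par cutB f_mem double by auto
    ultimately show False using sum by simp
  qed
  have A3: "card (edge_cut E inc ?A) = 3"
    using card_cut_ge_3[OF AV(1)] card_cut_ge_3[OF AV(2)] oddA par sum by simp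
  have sub: "edge_cut M1 inc ?A \<subseteq> edge_cut E inc ?A" by (auto simp: cut_sub[OF pms_sub(1)])
  have "f2 \<noteq> f3" using f_mem not_triple by auto
  have "card {f2, f3} \<le> card (edge_cut M1 inc ?A)"
    using cutA f_mem by (intro card_mono finite_cut pms_sub) (auto simp: edge_cut_def)
  then have "2 \<le> card (edge_cut M1 inc ?A)" using \<open>f2 \<noteq> f3\<close> by simp
  moreover have "odd (card (edge_cut M1 inc ?A))" using odd_card_cut_pm[OF pms(1) AV(1)] oddA by simp
  ultimately have "3 \<le> card (edge_cut M1 inc ?A)" by (cases "card (edge_cut M1 inc ?A) = 2") auto
  then have "edge_cut M1 inc ?A = edge_cut E inc ?A"
    using A3 sub finite_cut[of E ?A] by (intro card_seteq) auto
  then have "edge_cut E inc ?A \<subseteq> M1" by (auto simp: edge_cut_def)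
  moreover have "?A \<inter> hex_vertices = {v5, v6}" using memX memY by auto
  ultimately show ?thesis using AV oddA A3 by (simp add: pocket_def)
qed

text \<open>The first class of a 3-edge-colouring obtained by exchanging colours 2 and 3 inside X,
  colours 1 and 3 inside Y, and colours 1 and 2 inside Z. The other two classes are its images under the
  rotation of the hexagon.\<close>

definition recolour :: "'v set \<Rightarrow> 'v set \<Rightarrow> 'e set" where
  "recolour Y Z = {e \<in> E. e = f1 \<or> e = e3 \<or> e \<notin> hex_edges \<and>
     (if inc e \<subseteq> Y then e \<in> M3 else if inc e \<subseteq> Z then e \<in> M2 else e \<in> M1)}"

lemma exclusive:
  assumes "e \<notin> hex_edges"
  shows "e \<in> M1 \<Longrightarrow> e \<notin> M2" "e \<in> M1 \<Longrightarrow> e \<notin> M3" "e \<in> M2 \<Longrightarrow> e \<notin> M3"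
  using assms double by auto

text \<open>All edges leaving \<open>Y\<close> have colour 2 and all edges leaving \<open>Z\<close>
  have colour 3, so neither exchange affects them; at a vertex off the hexagon the new class thus
  agrees with one of the old matchings. Exchanging colours 2 and 3 leaves the first class unchanged,
  hence \<open>X\<close> does not occur. Opposite edges of the hexagon receive the same new colour,
  which fits the exchanged colours of the third edges.\<close>

lemma pm_recolour:
  assumes Y: "pocket V E inc M2 hex_vertices {v1, v2} Y"
    and Z: "pocket V E inc M3 hex_vertices {v3, v4} Z"
    and YZ: "Y \<inter> Z = {}"
  shows "pm (recolour Y Z)"
  unfolding pm_iff_ex1
proof (intro conjI ballI)
  interpret r: hexagon V E inc M2 M3 M1 v3 v4 v5 v6 v1 v2 e2 e3 e1 f2 f3 f1 by (rule rotate)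
  interpret s: hexagon V E inc M3 M1 M2 v5 v6 v1 v2 v3 v4 e3 e1 e2 f3 f1 f2 by (rule r.rotate)
  show "recolour Y Z \<subseteq> E" by (auto simp: recolour_def)
  have cutY: "edge_cut E inc Y \<subseteq> M2" and cutZ: "edge_cut E inc Z \<subseteq> M3"
    using Y Z by (auto simp: pocket_def)
  have memY: "v1 \<in> Y" "v2 \<in> Y" "v3 \<notin> Y" "v4 \<notin> Y" "v5 \<notin> Y" "v6 \<notin> Y" using dist by (auto simp: pocket_mem[OF Y])
  have memZ: "v1 \<notin> Z" "v2 \<notin> Z" "v3 \<in> Z" "v4 \<in> Z" "v5 \<notin> Z" "v6 \<notin> Z" using dist by (auto simp: pocket_mem[OF Z])
  have inY: "inc e \<subseteq> Y \<or> e \<in> M2" if "e \<in> E" "v \<in> inc e" "v \<in> Y" for e v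
    using that cutY by (auto simp: edge_cut_def)
  have inZ: "inc e \<subseteq> Z \<or> e \<in> M3" if "e \<in> E" "v \<in> inc e" "v \<in> Z" for e v
    using that cutZ by (auto simp: edge_cut_def)
  have hexE: "distinct [e1, e2, e3, f1, f2, f3]"
    using e_mem f_mem not_triple inc_e dist by (auto simp: doubleton_eq_iff)
  let ?N = "recolour Y Z"
  have ex1: "\<exists>!e. e \<in> ?N \<and> v \<in> inc e"
    if "{e \<in> E. v \<in> inc e} = A" "A \<inter> ?N = {a}" for v A a
  proof -
    have "{e \<in> E. v \<in> inc e} \<inter> ?N = {a}" using that by simp
    moreover have "?N \<subseteq> E" by (auto simp: recolour_def)
    ultimately have "e \<in> ?N \<and> v \<in> inc e \<longleftrightarrow> e = a" for e by blast
    then show ?thesis by simp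
  qed
  fix v assume vV: "v \<in> V"
  show "\<exists>!e. e \<in> ?N \<and> v \<in> inc e"
  proof (cases "v \<in> hex_vertices")
    case False
    then have nh: "e \<notin> hex_edges" if "v \<in> inc e" for e using that inc_e inc_f by auto
    consider "v \<in> Y" | "v \<in> Z" "v \<notin> Y" | "v \<notin> Y" "v \<notin> Z" by blast
    then have "\<exists>M. pm M \<and> (\<forall>e. v \<in> inc e \<longrightarrow> (e \<in> ?N \<longleftrightarrow> e \<in> M))"
    proof cases
      case 1
      have "e \<in> ?N \<longleftrightarrow> e \<in> M3" if e: "v \<in> inc e" for e
      proof (cases "e \<in> E")
        case True
        have "\<not> inc e \<subseteq> Z" using e 1 YZ by blast
        then show ?thesis using inY[OF True e 1] exclusive[OF nh[OF e]] nh[OF e] True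
          by (auto simp: recolour_def)
      qed (use pms_sub in \<open>auto simp: recolour_def\<close>)
      then show ?thesis using pms by blast
    next
      case 2
      have "e \<in> ?N \<longleftrightarrow> e \<in> M2" if e: "v \<in> inc e" for e
      proof (cases "e \<in> E")
        case True
        have "\<not> inc e \<subseteq> Y" using e 2 by blast
        then show ?thesis using inZ[OF True e 2(1)] exclusive[OF nh[OF e]] nh[OF e] True
          by (auto simp: recolour_def)
      qed (use pms_sub in \<open>auto simp: recolour_def\<close>)
      then show ?thesis using pms by blast
    next
      case 3
      have "e \<in> ?N \<longleftrightarrow> e \<in> M1" if e: "v \<in> inc e" for e
        using nh[OF e] e 3 pms_sub by (auto simp: recolour_def)
      then show ?thesis using pms by blast
    qed
    then obtain M where "pm M" "\<And>e. v \<in> inc e \<Longrightarrow> e \<in> ?N \<longleftrightarrow> e \<in> M" by blast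
    then show ?thesis using vV unfolding pm_iff_ex1 by metis
  next
    case True
    then consider "v = v1" | "v = v2" | "v = v3" | "v = v4" | "v = v5" | "v = v6" by blast
    then show ?thesis
    proof cases
      case 1
      obtain g where g: "{e \<in> E. v1 \<in> inc e} = {e1, f3, g}" "g \<in> M3" "g \<notin> M1" "g \<notin> M2" "g \<notin> hex_edges" "v1 \<in> inc g"
        by (rule third_edge_v1)
      have "inc g \<subseteq> Y" using inY[of g v1] g pms_sub memY by auto
      then have "{e1, f3, g} \<inter> ?N = {g}" using g hexE pms_sub by (auto simp: recolour_def)
      then show ?thesis using ex1[OF g(1)] 1 by simp
    next
      case 2
      obtain g where g: "{e \<in> E. v2 \<in> inc e} = {e1, f1, g}" "g \<in> M1" "g \<notin> M2" "g \<notin> M3" "g \<notin> hex_edges" "v2 \<in> inc g"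
        by (rule third_edge_v2)
      have "inc g \<subseteq> Y" using inY[of g v2] g pms_sub memY by auto
      then have "{e1, f1, g} \<inter> ?N = {f1}" using g hexE f_mem by (auto simp: recolour_def)
      then show ?thesis using ex1[OF g(1)] 2 by simp
    next
      case 3
      obtain g where g: "{e \<in> E. v3 \<in> inc e} = {e2, f1, g}" "g \<in> M1" "g \<notin> M2" "g \<notin> M3"
          "g \<notin> {e2, e3, e1, f2, f3, f1}" "v3 \<in> inc g"
        by (rule r.third_edge_v1)
      have "inc g \<subseteq> Z" "\<not> inc g \<subseteq> Y" using inZ[of g v3] g pms_sub memZ memY by auto
      then have "{e2, f1, g} \<inter> ?N = {f1}" using g hexE f_mem by (auto simp: recolour_def)
      then show ?thesis using ex1[OF g(1)] 3 by simp
    next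
      case 4
      obtain g where g: "{e \<in> E. v4 \<in> inc e} = {e2, f2, g}" "g \<in> M2" "g \<notin> M3" "g \<notin> M1"
          "g \<notin> {e2, e3, e1, f2, f3, f1}" "v4 \<in> inc g"
        by (rule r.third_edge_v2)
      have "inc g \<subseteq> Z" "\<not> inc g \<subseteq> Y" using inZ[of g v4] g pms_sub memZ memY by auto
      then have "{e2, f2, g} \<inter> ?N = {g}" using g hexE pms_sub by (auto simp: recolour_def)
      then show ?thesis using ex1[OF g(1)] 4 by simp
    next
      case 5
      obtain g where g: "{e \<in> E. v5 \<in> inc e} = {e3, f2, g}" "g \<in> M2" "g \<notin> M3" "g \<notin> M1"
          "g \<notin> {e3, e1, e2, f3, f1, f2}" "v5 \<in> inc g"
        by (rule s.third_edge_v1)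
      have "\<not> inc g \<subseteq> Z" "\<not> inc g \<subseteq> Y" using g memZ memY by auto
      then have "{e3, f2, g} \<inter> ?N = {e3}" using g hexE e_mem by (auto simp: recolour_def)
      then show ?thesis using ex1[OF g(1)] 5 by simp
    next
      case 6
      obtain g where g: "{e \<in> E. v6 \<in> inc e} = {e3, f3, g}" "g \<in> M3" "g \<notin> M1" "g \<notin> M2"
          "g \<notin> {e3, e1, e2, f3, f1, f2}" "v6 \<in> inc g"
        by (rule s.third_edge_v2)
      have "\<not> inc g \<subseteq> Z" "\<not> inc g \<subseteq> Y" using g memZ memY by auto
      then have "{e3, f3, g} \<inter> ?N = {e3}" using g hexE e_mem by (auto simp: recolour_def)
      then show ?thesis using ex1[OF g(1)] 6 by simp
    qed
  qed
qed

text \<open>Uncrossing shrinks only the first of the two sets, so only \<open>X\<close> has to be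
  minimal. Going round the three pairs cyclically uses the minimality of each set once.\<close>

lemma minimal_pocket_disjoint:
  assumes X: "pocket V E inc M1 hex_vertices {v5, v6} X"
    and min: "\<And>X'. pocket V E inc M1 hex_vertices {v5, v6} X' \<Longrightarrow> card X \<le> card X'"
    and Y: "pocket V E inc M2 hex_vertices {v1, v2} Y"
  shows "X \<inter> Y = {}"
proof (rule ccontr)
  assume "X \<inter> Y \<noteq> {}"
  moreover have "finite X" using X finV finite_subset by (auto simp: pocket_def)
  ultimately have "card (X - Y) < card X" by (intro psubset_card_mono) auto
  then show False using min[OF pocket_uncross[OF X Y]] by simp
qed

lemma three_pockets_colourable:
  assumes X: "pocket V E inc M1 hex_vertices {v5, v6} X0"
    and Y: "pocket V E inc M2 hex_vertices {v1, v2} Y0"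
    and Z: "pocket V E inc M3 hex_vertices {v3, v4} Z0"
  shows "\<exists>N1 N2 N3. pm N1 \<and> pm N2 \<and> pm N3 \<and> N1 \<union> N2 \<union> N3 = E"
proof -
  interpret r: hexagon V E inc M2 M3 M1 v3 v4 v5 v6 v1 v2 e2 e3 e1 f2 f3 f1 by (rule rotate)
  interpret s: hexagon V E inc M3 M1 M2 v5 v6 v1 v2 v3 v4 e3 e1 e2 f3 f1 f2 by (rule r.rotate)
  have rot: "{v3, v4, v5, v6, v1, v2} = hex_vertices" "{v5, v6, v1, v2, v3, v4} = hex_vertices" by auto
  obtain X where X: "pocket V E inc M1 hex_vertices {v5, v6} X"
    and minX: "\<And>X'. pocket V E inc M1 hex_vertices {v5, v6} X' \<Longrightarrow> card X \<le> card X'"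
    using minimal_pocket[OF X] by metis
  obtain Y where Y: "pocket V E inc M2 hex_vertices {v1, v2} Y"
    and minY: "\<And>X'. pocket V E inc M2 hex_vertices {v1, v2} X' \<Longrightarrow> card Y \<le> card X'"
    using minimal_pocket[OF Y] by metis
  obtain Z where Z: "pocket V E inc M3 hex_vertices {v3, v4} Z"
    and minZ: "\<And>X'. pocket V E inc M3 hex_vertices {v3, v4} X' \<Longrightarrow> card Z \<le> card X'"
    using minimal_pocket[OF Z] by metis
  have XY: "X \<inter> Y = {}" using minimal_pocket_disjoint[OF X minX Y] .
  have YZ: "Y \<inter> Z = {}" using r.minimal_pocket_disjoint[unfolded rot, OF Y minY Z] .
  have ZX: "Z \<inter> X = {}" using s.minimal_pocket_disjoint[unfolded rot, OF Z minZ X] .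
  let ?N1 = "recolour Y Z" and ?N2 = "r.recolour Z X" and ?N3 = "s.recolour X Y"
  have "pm ?N1" using pm_recolour[OF Y Z YZ] .
  moreover have "pm ?N2" using r.pm_recolour[unfolded rot, OF Z X ZX] .
  moreover have "pm ?N3" using s.pm_recolour[unfolded rot, OF X Y XY] .
  moreover have "?N1 \<union> ?N2 \<union> ?N3 = E"
  proof
    show "E \<subseteq> ?N1 \<union> ?N2 \<union> ?N3"
    proof
      fix e assume e: "e \<in> E"
      show "e \<in> ?N1 \<union> ?N2 \<union> ?N3"
      proof (cases "e \<in> hex_edges")
        case True
        then show ?thesis using e by (auto simp: recolour_def r.recolour_def s.recolour_def)
      next
        case False
        then have "e \<in> M1 \<or> e \<in> M2 \<or> e \<in> M3" using uncovered e by blast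
        \<comment> \<open>A nonempty \<open>inc e\<close> lies in at most one of the disjoint sets,
          so at most one exchange applies to \<open>e\<close>, and \<open>e\<close> keeps some
          colour.\<close>
        moreover have "inc e \<noteq> {}" using card_inc[OF e] by auto
        ultimately show ?thesis using False e XY YZ ZX
          by (auto simp: recolour_def r.recolour_def s.recolour_def)
      qed
    qed
  qed (auto simp: recolour_def r.recolour_def s.recolour_def)
  ultimately show ?thesis by blast
qed

lemma five_cover:
  assumes "\<nexists>N1 N2 N3. pm N1 \<and> pm N2 \<and> pm N3 \<and> N1 \<union> N2 \<union> N3 = E"
  shows "\<exists>N N'. pm N \<and> pm N' \<and> {e1, e2, e3} \<subseteq> N \<union> N'"
proof -
  interpret r: hexagon V E inc M2 M3 M1 v3 v4 v5 v6 v1 v2 e2 e3 e1 f2 f3 f1 by (rule rotate)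
  interpret s: hexagon V E inc M3 M1 M2 v5 v6 v1 v2 v3 v4 e3 e1 e2 f3 f1 f2 by (rule r.rotate)
  have rot: "{v3, v4, v5, v6, v1, v2} = hex_vertices" "{v5, v6, v1, v2, v3, v4} = hex_vertices" by auto
  have "(\<exists>N. pm N \<and> e1 \<in> N \<and> e2 \<in> N) \<or> (\<exists>N. pm N \<and> e2 \<in> N \<and> e3 \<in> N) \<or> (\<exists>N. pm N \<and> e3 \<in> N \<and> e1 \<in> N)"
    using pocket_if_no_pm r.pocket_if_no_pm[unfolded rot] s.pocket_if_no_pm[unfolded rot]
      three_pockets_colourable assms by blast
  then show ?thesis
    using pm_containing_edge[OF e_mem(1)] pm_containing_edge[OF e_mem(2)] pm_containing_edge[OF e_mem(3)]
    by blast
qed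

end

section \<open>Finding the hexagon in three optimal matchings\<close>

lemma alternating_hexagon:
  assumes two: "\<And>e. e \<in> U \<union> D \<Longrightarrow> card (inc e) = 2"
    and uniqU: "\<And>e e' v. e \<in> U \<Longrightarrow> e' \<in> U \<Longrightarrow> v \<in> inc e \<Longrightarrow> v \<in> inc e' \<Longrightarrow> e = e'"
    and uniqD: "\<And>e e' v. e \<in> D \<Longrightarrow> e' \<in> D \<Longrightarrow> v \<in> inc e \<Longrightarrow> v \<in> inc e' \<Longrightarrow> e = e'"
    and same: "\<Union>(inc ` U) = \<Union>(inc ` D)"
    and card: "card U = 3"
    and not_parallel: "\<And>e f. e \<in> U \<Longrightarrow> f \<in> D \<Longrightarrow> inc e \<noteq> inc f"
  obtains v1 v2 v3 v4 v5 v6 e1 e2 e3 f1 f2 f3 where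
    "distinct [v1, v2, v3, v4, v5, v6]"
    "inc e1 = {v1, v2}" "inc e2 = {v3, v4}" "inc e3 = {v5, v6}"
    "inc f1 = {v2, v3}" "inc f2 = {v4, v5}" "inc f3 = {v6, v1}"
    "U = {e1, e2, e3}" "D = {f1, f2, f3}"
proof -
  have atD: "\<exists>f w. f \<in> D \<and> inc f = {v, w} \<and> v \<noteq> w" if v: "e \<in> U" "v \<in> inc e" for e v
  proof -
    obtain f where f: "f \<in> D" "v \<in> inc f" using v same by blast
    then show ?thesis using two[of f] card_2_other[of "inc f" v] by (metis UnI2)
  qed
  have atU: "\<exists>e w. e \<in> U \<and> inc e = {v, w} \<and> v \<noteq> w" if v: "f \<in> D" "v \<in> inc f" for f v
  proof -
    obtain e where e: "e \<in> U" "v \<in> inc e" using v same by blast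
    then show ?thesis using two[of e] card_2_other[of "inc e" v] by (metis UnI1)
  qed
  obtain e1 where e1: "e1 \<in> U" using card by fastforce
  then obtain v1 v2 where v12: "inc e1 = {v1, v2}" "v1 \<noteq> v2" using two[of e1] by (auto simp: card_2_iff)
  obtain f1 v3 where f1: "f1 \<in> D" "inc f1 = {v2, v3}" "v2 \<noteq> v3" using atD[OF e1, of v2] v12 by blast
  have "v3 \<noteq> v1" using not_parallel[OF e1 f1(1)] v12 f1 by auto
  obtain e2 v4 where e2: "e2 \<in> U" "inc e2 = {v3, v4}" "v3 \<noteq> v4" using atU[OF f1(1), of v3] f1 by blast
  have "e2 \<noteq> e1" using e2 v12 f1 \<open>v3 \<noteq> v1\<close> by auto
  then have v4: "v4 \<noteq> v1" "v4 \<noteq> v2" using uniqU[OF e1 e2(1), of v4] e2 v12 by auto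
  obtain f2 v5 where f2: "f2 \<in> D" "inc f2 = {v4, v5}" "v4 \<noteq> v5" using atD[OF e2(1), of v4] e2 by blast
  have "f2 \<noteq> f1" using f2 f1 v4 e2 by auto
  then have v5: "v5 \<noteq> v2" "v5 \<noteq> v3" using uniqD[OF f1(1) f2(1), of v5] f2 f1 by auto
  obtain e3 where e3: "e3 \<in> U" "e3 \<noteq> e1" "e3 \<noteq> e2" "U = {e1, e2, e3}"
  proof -
    have "card (U - {e1, e2}) = 1" using card e1 e2 \<open>e2 \<noteq> e1\<close> by (simp add: card_Diff_subset)
    then obtain e3 where "U - {e1, e2} = {e3}" by (auto simp: card_1_singleton_iff)
    then show ?thesis using that[of e3] e1 e2 by blast
  qed
  \<comment> \<open>If the cycle closed after four edges, the edge of \<open>D\<close> at the end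
    \<open>z\<close> of \<open>e3\<close> could only lead to the other end of \<open>e3\<close>,
    which would make the two parallel.\<close>
  have "v5 \<noteq> v1"
  proof
    assume eq: "v5 = v1"
    obtain z w where zw: "inc e3 = {z, w}" "z \<noteq> w" using two[of e3] e3 by (auto simp: card_2_iff)
    have new: "z \<notin> {v1, v2, v3, v4}"
      using uniqU[OF e1 e3(1), of z] uniqU[OF e2(1) e3(1), of z] e3 v12 e2 zw by auto
    obtain f x where f: "f \<in> D" "inc f = {z, x}" "z \<noteq> x" using atD[OF e3(1), of z] zw by blast
    have "f \<noteq> f1" "f \<noteq> f2" using f f1 f2 new eq by auto
    then have "x \<notin> {v1, v2, v3, v4}"
      using uniqD[OF f1(1) f(1), of x] uniqD[OF f2(1) f(1), of x] f f1 f2 eq by auto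
    moreover have "x \<in> \<Union>(inc ` U)" using f same by auto
    ultimately have "x \<in> {z, w}" using e3 zw v12 e2 by auto
    then show False using not_parallel[OF e3(1) f(1)] f zw by auto
  qed
  have "v5 \<in> \<Union>(inc ` U)" using f2 same by auto
  then have "v5 \<in> inc e3" using e3 v12 e2 v5 f2 \<open>v5 \<noteq> v1\<close> by auto
  then obtain v6 where v6: "inc e3 = {v5, v6}" "v5 \<noteq> v6" using card_2_other[of "inc e3" v5] two[of e3] e3 by blast
  have v6n: "v6 \<notin> {v1, v2, v3, v4}"
    using uniqU[OF e1 e3(1), of v6] uniqU[OF e2(1) e3(1), of v6] e3 v12 e2 v6 by auto
  obtain f3 x where f3: "f3 \<in> D" "inc f3 = {v6, x}" "v6 \<noteq> x" using atD[OF e3(1), of v6] v6 by blast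
  have "f3 \<noteq> f1" "f3 \<noteq> f2" using f3 f1 f2 v6 v6n by auto
  then have "x \<notin> {v2, v3, v4, v5}"
    using uniqD[OF f1(1) f3(1), of x] uniqD[OF f2(1) f3(1), of x] f3 f1 f2 by auto
  moreover have "x \<in> \<Union>(inc ` U)" using f3 same by auto
  ultimately have "x = v1" using e3 v12 e2 v6 f3 by auto
  have "f \<in> {f1, f2, f3}" if f: "f \<in> D" for f
  proof -
    obtain z where z: "z \<in> inc f" using two[of f] f by (auto simp: card_2_iff)
    then have "z \<in> \<Union>(inc ` U)" using f same by blast
    then have "z \<in> {v1, v2, v3, v4, v5, v6}" using e3 v12 e2 v6 by auto
    then show ?thesis
      using uniqD[OF f f1(1), of z] uniqD[OF f f2(1), of z] uniqD[OF f f3(1), of z] z f1 f2 f3 \<open>x = v1\<close> by auto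
  qed
  then have "D = {f1, f2, f3}" using f1 f2 f3 by blast
  moreover have "distinct [v1, v2, v3, v4, v5, v6]"
    using v12 f1 e2 f2 v6 v6n v4 v5 \<open>v3 \<noteq> v1\<close> \<open>v5 \<noteq> v1\<close> by auto
  ultimately show ?thesis
    using that[of v1 v2 v3 v4 v5 v6 e1 e2 e3 f1 f2 f3] v12 f1 e2 f2 v6 f3 e3 \<open>x = v1\<close> by blast
qed

context bridgeless_cubic
begin

text \<open>\<open>U\<close> covers exactly the vertices that \<open>D\<close> releases, each of
  them once. This form serves the exchange of parallel edges as well as that along the whole
  hexagon.\<close>

lemma pm_exchange:
  assumes M: "pm M" and DM: "D \<subseteq> M" and U: "U \<subseteq> E"
    and uniqU: "\<And>e e' v. e \<in> U \<Longrightarrow> e' \<in> U \<Longrightarrow> v \<in> inc e \<Longrightarrow> v \<in> inc e' \<Longrightarrow> e = e'"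
    and same: "\<Union>(inc ` U) = \<Union>(inc ` D)"
  shows "pm (M - D \<union> U)"
  unfolding pm_iff_ex1
proof (intro conjI ballI)
  show "M - D \<union> U \<subseteq> E" using M U by (auto simp: pm_iff)
  fix v assume v: "v \<in> V"
  then obtain m where m: "m \<in> M" "v \<in> inc m" and uniq: "\<And>e. e \<in> M \<Longrightarrow> v \<in> inc e \<Longrightarrow> e = m"
    using M unfolding pm_iff_ex1 by metis
  show "\<exists>!e. e \<in> M - D \<union> U \<and> v \<in> inc e"
  proof (cases "m \<in> D")
    case True
    then obtain u where u: "u \<in> U" "v \<in> inc u" using same m by blast
    have "e = u" if "e \<in> M - D \<union> U" "v \<in> inc e" for e
      using that uniq[of e] uniqU[of e u v] u True by blast
    then show ?thesis using u by blast
  next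
    case False
    have "v \<notin> \<Union>(inc ` U)" using same uniq DM False by auto
    then show ?thesis using m uniq False by blast
  qed
qed

text \<open>After leaving \<open>M\<close>, the edge \<open>f\<close> is still covered by
  \<open>N\<close>; the exchange gains \<open>e\<close> and loses nothing.\<close>

lemma parallel_exchange:
  assumes "pm M" "pm N" "pm L" "e \<in> E - (M \<union> N \<union> L)" "f \<in> M \<inter> N" "inc e = inc f"
  shows "\<exists>M'. pm M' \<and> card (E - (M' \<union> N \<union> L)) < card (E - (M \<union> N \<union> L))"
proof -
  have "pm (M - {f} \<union> {e})" using assms by (intro pm_exchange) auto
  moreover have "card (E - ((M - {f} \<union> {e}) \<union> N \<union> L)) < card (E - (M \<union> N \<union> L))"
    using assms finE by (intro psubset_card_mono) auto
  ultimately show ?thesis by blast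
qed

lemma hexagonI:
  assumes "pm M1" "pm M2" "pm M3" "distinct [v1, v2, v3, v4, v5, v6]"
    "inc e1 = {v1, v2}" "inc e2 = {v3, v4}" "inc e3 = {v5, v6}"
    "inc f1 = {v2, v3}" "inc f2 = {v4, v5}" "inc f3 = {v6, v1}"
    and U: "E - (M1 \<union> M2 \<union> M3) = {e1, e2, e3}"
    and D: "(M1 \<inter> M2) \<union> (M2 \<inter> M3) \<union> (M3 \<inter> M1) = {f1, f2, f3}"
    and miss: "f1 \<notin> M1" "f2 \<notin> M2" "f3 \<notin> M3"
  shows "hexagon V E inc M1 M2 M3 v1 v2 v3 v4 v5 v6 e1 e2 e3 f1 f2 f3"
proof
  have mem: "f1 \<in> M2" "f1 \<in> M3" "f2 \<in> M3" "f2 \<in> M1" "f3 \<in> M1" "f3 \<in> M2"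
    using equalityD2[OF D] miss by auto
  have "M2 \<inter> M3 \<subseteq> {f1, f2, f3}" "M3 \<inter> M1 \<subseteq> {f1, f2, f3}" "M1 \<inter> M2 \<subseteq> {f1, f2, f3}"
    using equalityD1[OF D] by auto
  then show "M2 \<inter> M3 = {f1}" "M3 \<inter> M1 = {f2}" "M1 \<inter> M2 = {f3}"
    using mem miss by auto
qed (use assms in auto)

lemma hexagon_exists:
  assumes pms: "pm M1" "pm M2" "pm M3" and defect: "card (E - (M1 \<union> M2 \<union> M3)) = 3"
    and min: "\<And>N1 N2 N3. pm N1 \<Longrightarrow> pm N2 \<Longrightarrow> pm N3 \<Longrightarrow> 3 \<le> card (E - (N1 \<union> N2 \<union> N3))"
  shows "\<exists>N1 N2 N3 v1 v2 v3 v4 v5 v6 e1 e2 e3 f1 f2 f3.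
    hexagon V E inc N1 N2 N3 v1 v2 v3 v4 v5 v6 e1 e2 e3 f1 f2 f3"
proof -
  define U where "U = E - (M1 \<union> M2 \<union> M3)"
  define D where "D = (M1 \<inter> M2) \<union> (M2 \<inter> M3) \<union> (M3 \<inter> M1)"
  have sub: "M1 \<subseteq> E" "M2 \<subseteq> E" "M3 \<subseteq> E" using pms by (auto simp: pm_iff)
  have finU: "finite U" using finE by (simp add: U_def)
  have perm: "M1 \<union> M3 \<union> M2 = M1 \<union> M2 \<union> M3" "M2 \<union> M3 \<union> M1 = M1 \<union> M2 \<union> M3" by auto
  have not_parallel: "inc e \<noteq> inc f" if eU: "e \<in> U" and fD: "f \<in> D" for e f
  proof
    assume par: "inc e = inc f"
    have "f \<in> M1 \<inter> M2 \<or> f \<in> M2 \<inter> M3 \<or> f \<in> M1 \<inter> M3" using fD by (auto simp: D_def)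
    then obtain N1 N2 N3 where "pm N1" "pm N2" "pm N3" "card (E - (N1 \<union> N2 \<union> N3)) < 3"
      using parallel_exchange[OF pms(1,2,3), of e f] parallel_exchange[OF pms(2,3,1), of e f, unfolded perm]
        parallel_exchange[OF pms(1,3,2), of e f, unfolded perm] eU par pms defect
      unfolding U_def by metis
    then show False using min[of N1 N2 N3] by simp
  qed
  \<comment> \<open>A triply covered edge leaves the two other edges at each of its ends uncovered.
    Since only three edges are uncovered, one of them is common to both ends and hence parallel to
    it.\<close>
  have no_triple: "M1 \<inter> M2 \<inter> M3 = {}"
  proof (rule ccontr)
    assume "M1 \<inter> M2 \<inter> M3 \<noteq> {}"
    then obtain t where t: "t \<in> M1" "t \<in> M2" "t \<in> M3" by blast
    then have tE: "t \<in> E" using sub by blast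
    obtain u v where uv: "inc t = {u, v}" "u \<noteq> v" using card_inc[OF tE] by (auto simp: card_2_iff)
    define A where "A x = {e \<in> E. x \<in> inc e} - {t}" for x
    have A: "card (A x) = 2" "A x \<subseteq> U" if x: "x \<in> inc t" for x
    proof -
      have "x \<in> V" using inc_V[OF tE] x by blast
      then show "card (A x) = 2" using deg x tE unfolding A_def by simp
      show "A x \<subseteq> U"
      proof
        fix e assume "e \<in> A x"
        then have e: "e \<in> E" "x \<in> inc e" "e \<noteq> t" by (auto simp: A_def)
        then show "e \<in> U"
          using pm_unique[OF pms(1) _ t(1) e(2) x] pm_unique[OF pms(2) _ t(2) e(2) x]
            pm_unique[OF pms(3) _ t(3) e(2) x] unfolding U_def by blast
      qed
    qed
    have fin: "finite (A x)" for x using finE by (simp add: A_def)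
    have "card (A u \<union> A v) \<le> 3"
      using card_mono[OF finU, of "A u \<union> A v"] A uv defect by (simp add: U_def)
    then have "card (A u \<inter> A v) \<noteq> 0" using card_Un_Int[OF fin fin, of u v] A uv by simp
    then obtain e where e: "e \<in> A u" "e \<in> A v" by (metis Int_iff card.empty ex_in_conv)
    then have "e \<in> E" "{u, v} \<subseteq> inc e" by (auto simp: A_def)
    then have "inc e = inc t"
      using card_inc[of e] finite_inc[of e] uv card_seteq[of "inc e" "{u, v}"] by auto
    moreover have "e \<in> U" using A(2)[of u] e uv by blast
    ultimately show False using not_parallel[of e t] t by (auto simp: D_def)
  qed
  \<comment> \<open>The matching edges \<open>m1\<close>, \<open>m2\<close>, \<open>m3\<close> at
    \<open>v\<close> include at least two distinct ones. So at most one edge at \<open>v\<close> is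
    uncovered, and one is exactly when two of them coincide, that is, when a doubly covered edge is
    present.\<close>
  have local: "card {e \<in> U. v \<in> inc e} \<le> 1 \<and> ((\<exists>e\<in>U. v \<in> inc e) \<longleftrightarrow> (\<exists>e\<in>D. v \<in> inc e))"
    if v: "v \<in> V" for v
  proof -
    obtain m1 m2 m3 where m: "m1 \<in> M1" "v \<in> inc m1" "m2 \<in> M2" "v \<in> inc m2" "m3 \<in> M3" "v \<in> inc m3"
      using pms v unfolding pm_iff_ex1 by metis
    have u1: "e \<in> M1 \<longleftrightarrow> e = m1" if "v \<in> inc e" for e
      using pm_unique[OF pms(1) _ m(1) that m(2)] m(1) by blast
    have u2: "e \<in> M2 \<longleftrightarrow> e = m2" if "v \<in> inc e" for e
      using pm_unique[OF pms(2) _ m(3) that m(4)] m(3) by blast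
    have u3: "e \<in> M3 \<longleftrightarrow> e = m3" if "v \<in> inc e" for e
      using pm_unique[OF pms(3) _ m(5) that m(6)] m(5) by blast
    let ?A = "{e \<in> E. v \<in> inc e}" and ?B = "{m1, m2, m3}"
    have "{e \<in> U. v \<in> inc e} = ?A - ?B" by (auto simp: U_def u1 u2 u3)
    moreover have "?B \<subseteq> ?A" using m sub by auto
    ultimately have cU: "card {e \<in> U. v \<in> inc e} = 3 - card ?B" using deg[OF v] by (simp add: card_Diff_subset)
    have D: "(\<exists>e\<in>D. v \<in> inc e) \<longleftrightarrow> m1 = m2 \<or> m2 = m3 \<or> m3 = m1"
    proof -
      have "e \<in> D \<longleftrightarrow> e = m1 \<and> e = m2 \<or> e = m2 \<and> e = m3 \<or> e = m3 \<and> e = m1" if "v \<in> inc e" for e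
        using u1[OF that] u2[OF that] u3[OF that] by (simp add: D_def)
      then show ?thesis using m by metis
    qed
    have ge: "2 \<le> card ?B" using no_triple m by (auto simp: card_insert_if)
    have "(\<exists>e\<in>U. v \<in> inc e) \<longleftrightarrow> card {e \<in> U. v \<in> inc e} \<noteq> 0" using finU by auto
    also have "\<dots> \<longleftrightarrow> m1 = m2 \<or> m2 = m3 \<or> m3 = m1" using cU ge by (auto simp: card_insert_if split: if_splits)
    finally show ?thesis using D cU ge by simp
  qed
  have UE: "U \<subseteq> E" and DE: "D \<subseteq> E" using sub by (auto simp: U_def D_def)
  have uniqU: "e = e'" if "e \<in> U" "e' \<in> U" "v \<in> inc e" "v \<in> inc e'" for e e' v
  proof -
    have "v \<in> V" using that UE inc_V by blast
    then have "card {e \<in> U. v \<in> inc e} \<le> Suc 0" using local by simp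
    then show ?thesis using that finU card_le_Suc0_iff_eq[of "{e \<in> U. v \<in> inc e}"] by simp
  qed
  have uniqD: "e = e'" if "e \<in> D" "e' \<in> D" "v \<in> inc e" "v \<in> inc e'" for e e' v
    using that pm_unique[OF pms(1), of e e' v] pm_unique[OF pms(2), of e e' v] pm_unique[OF pms(3), of e e' v]
    unfolding D_def by blast
  have same: "\<Union>(inc ` U) = \<Union>(inc ` D)"
  proof -
    have "v \<in> \<Union>(inc ` U) \<longleftrightarrow> v \<in> \<Union>(inc ` D)" for v
      using local[of v] inc_V UE DE by (cases "v \<in> V") blast+
    then show ?thesis by blast
  qed
  have two: "card (inc e) = 2" if "e \<in> U \<union> D" for e using that UE DE card_inc by blast
  obtain v1 v2 v3 v4 v5 v6 e1 e2 e3 f1 f2 f3 where hex: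
    "distinct [v1, v2, v3, v4, v5, v6]"
    "inc e1 = {v1, v2}" "inc e2 = {v3, v4}" "inc e3 = {v5, v6}"
    "inc f1 = {v2, v3}" "inc f2 = {v4, v5}" "inc f3 = {v6, v1}"
    and U: "U = {e1, e2, e3}" and D: "D = {f1, f2, f3}"
    by (rule alternating_hexagon[OF two uniqU uniqD same _ not_parallel]) (use defect U_def in auto)
  \<comment> \<open>Each edge of \<open>D\<close> lies in a second matching as well, so exchanging
    \<open>D\<close> for \<open>U\<close> inside \<open>M\<close> would leave nothing
    uncovered.\<close>
  have not_in_one: "\<not> D \<subseteq> M" if "M \<in> {M1, M2, M3}" for M
  proof
    assume DM: "D \<subseteq> M"
    have "pm (M - D \<union> U)" using that pms DM UE uniqU same by (intro pm_exchange) auto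
    moreover have "\<exists>N L. pm N \<and> pm L \<and> E - ((M - D \<union> U) \<union> N \<union> L) = {}"
    proof -
      consider "M = M1" | "M = M2" | "M = M3" using \<open>M \<in> {M1, M2, M3}\<close> by blast
      then show ?thesis
      proof cases
        case 1
        have "E - ((M - D \<union> U) \<union> M2 \<union> M3) = {}" using 1 no_triple by (auto simp: U_def D_def)
        then show ?thesis using pms by blast
      next
        case 2
        have "E - ((M - D \<union> U) \<union> M1 \<union> M3) = {}" using 2 no_triple by (auto simp: U_def D_def)
        then show ?thesis using pms by blast
      next
        case 3
        have "E - ((M - D \<union> U) \<union> M1 \<union> M2) = {}" using 3 no_triple by (auto simp: U_def D_def)
        then show ?thesis using pms by blast
      qed
    qed
    ultimately show False using min by (metis card.empty not_numeral_le_zero)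
  qed
  have intro: ?thesis
    if "pm N1" "pm N2" "pm N3" "N1 \<union> N2 \<union> N3 = M1 \<union> M2 \<union> M3"
      "(N1 \<inter> N2) \<union> (N2 \<inter> N3) \<union> (N3 \<inter> N1) = D"
      "f1 \<notin> N1" "f2 \<notin> N2" "f3 \<notin> N3" for N1 N2 N3
  proof -
    have "E - (N1 \<union> N2 \<union> N3) = {e1, e2, e3}" using that(4) U by (simp add: U_def)
    moreover have "(N1 \<inter> N2) \<union> (N2 \<inter> N3) \<union> (N3 \<inter> N1) = {f1, f2, f3}" using that(5) D by simp
    ultimately show ?thesis using hexagonI[OF that(1-3) hex] that(6-8) by blast
  qed
  \<comment> \<open>Each of the three edges is missed by exactly one matching, and each matching
    misses at least one of them. The assignment is thus a bijection, and its six possibilities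
    differ only in the order of the matchings.\<close>
  have "\<forall>f\<in>D. (f \<in> M1 \<and> f \<in> M2 \<and> f \<notin> M3) \<or> (f \<in> M1 \<and> f \<notin> M2 \<and> f \<in> M3) \<or> (f \<notin> M1 \<and> f \<in> M2 \<and> f \<in> M3)"
    using no_triple by (auto simp: D_def)
  moreover have "\<exists>f\<in>D. f \<notin> M1" "\<exists>f\<in>D. f \<notin> M2" "\<exists>f\<in>D. f \<notin> M3" using not_in_one by blast+
  ultimately consider "f1 \<notin> M1" "f2 \<notin> M2" "f3 \<notin> M3" | "f1 \<notin> M1" "f2 \<notin> M3" "f3 \<notin> M2"
    | "f1 \<notin> M2" "f2 \<notin> M1" "f3 \<notin> M3" | "f1 \<notin> M2" "f2 \<notin> M3" "f3 \<notin> M1"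
    | "f1 \<notin> M3" "f2 \<notin> M1" "f3 \<notin> M2" | "f1 \<notin> M3" "f2 \<notin> M2" "f3 \<notin> M1"
    unfolding D by (simp only: ball_simps bex_simps) argo
  then show ?thesis
    by cases (rule intro, use pms in \<open>(assumption | force simp: D_def)+\<close>)+
qed

section \<open>From the hexagon to a cover by five matchings\<close>

lemma five_matchings:
  assumes pms: "pm M1" "pm M2" "pm M3" and defect: "card (E - (M1 \<union> M2 \<union> M3)) = 3"
    and min: "\<And>N1 N2 N3. pm N1 \<Longrightarrow> pm N2 \<Longrightarrow> pm N3 \<Longrightarrow> 3 \<le> card (E - (N1 \<union> N2 \<union> N3))"
  shows "\<exists>\<M>. finite \<M> \<and> card \<M> \<le> 5 \<and> (\<forall>M\<in>\<M>. pm M) \<and> \<Union>\<M> = E"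
proof -
  obtain N1 N2 N3 v1 v2 v3 v4 v5 v6 e1 e2 e3 f1 f2 f3 where
    "hexagon V E inc N1 N2 N3 v1 v2 v3 v4 v5 v6 e1 e2 e3 f1 f2 f3"
    using hexagon_exists[OF assms] by blast
  then interpret h: hexagon V E inc N1 N2 N3 v1 v2 v3 v4 v5 v6 e1 e2 e3 f1 f2 f3 .
  have "\<nexists>N1 N2 N3. pm N1 \<and> pm N2 \<and> pm N3 \<and> N1 \<union> N2 \<union> N3 = E"
    using min by (metis Diff_cancel card.empty not_numeral_le_zero)
  then obtain N N' where N: "pm N" "pm N'" "{e1, e2, e3} \<subseteq> N \<union> N'" using h.five_cover by blast
  have "N \<subseteq> E" "N' \<subseteq> E" using N by (auto simp: pm_iff)
  then have "\<Union>{N1, N2, N3, N, N'} = E" using h.uncovered h.pms_sub N by auto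
  moreover have "card {N1, N2, N3, N, N'} \<le> 5" by (simp add: card_insert_if)
  ultimately show ?thesis using h.pms N by (intro exI[of _ "{N1, N2, N3, N, N'}"]) auto
qed

end

theorem theorem1p1:
  fixes V :: "'v set" and E :: "'e set" and inc :: "'e \<Rightarrow> 'v set"
  assumes "cubic V E inc"
    and "bridgeless E inc"
    and "colouring_defect V E inc = 3"
  shows "\<exists>\<M>. finite \<M> \<and> card \<M> \<le> 5 \<and>
           (\<forall>M\<in>\<M>. perfect_matching V E inc M) \<and> \<Union>\<M> = E"
proof -
  interpret bridgeless_cubic V E inc using assms(1,2) by (rule bridgeless_cubicI)
  let ?S = "{card (E - (M1 \<union> M2 \<union> M3)) | M1 M2 M3. pm M1 \<and> pm M2 \<and> pm M3}"
  have "?S \<subseteq> {..card E}" using finE by (auto intro: card_mono)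
  then have fin: "finite ?S" using finite_subset by blast
  \<comment> \<open>A perfect matching makes the set of values nonempty; together with finiteness
    this ensures that \<open>Min\<close> is attained.\<close>
  obtain M where "pm M" using pm_avoiding_two_edges[of "{}"] by auto
  then have "?S \<noteq> {}" by blast
  then have "Min ?S \<in> ?S" using fin by (rule Min_in[rotated])
  moreover have min3: "Min ?S = 3" using assms(3) by (simp add: colouring_defect_def)
  ultimately obtain M1 M2 M3 where "pm M1" "pm M2" "pm M3" "card (E - (M1 \<union> M2 \<union> M3)) = 3"
    by auto
  then show ?thesis
  proof (rule five_matchings)
    fix N1 N2 N3 assume "pm N1" "pm N2" "pm N3"
    then have "card (E - (N1 \<union> N2 \<union> N3)) \<in> ?S" by blast
    from Min_le[OF fin this] show "3 \<le> card (E - (N1 \<union> N2 \<union> N3))" unfolding min3 .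
  qed
qed

end
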